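(* Let $\mathbf g$ be a Riemannian metric on a manifold $M$ with an orthogonal splitting $TM=\mathcal H\oplus_\perp\mathcal V$, and use this decomposition to define the connection $\mathring\nabla$. Write $\mathbf g|_{\mathcal H}=\mathbf h$ and $\mathbf g|_{\mathcal V}=\mathbf v$, and let $\mathbf h^*$ and $\mathbf v^*$ be their respective co-metrics. Then $$\Gamma^{\mathbf h^*}(f,\Gamma^{\mathbf v^*}(f))=\Gamma^{\mathbf v^*}(f,\Gamma^{\mathbf h^*}(f))$$ holds for every $f\in C^\infty(M)$ if and only if $\mathring\nabla\mathbf v^*=\mathring\nabla\mathbf h^*=0$.
   Context: With $\nabla$ the Levi-Civita connection of $\mathbf g$ and $\mathrm{pr}_{\mathcal H},\mathrm{pr}_{\mathcal V}$ the orthogonal projections, $$\mathring\nabla_AZ=\mathrm{pr}_{\mathcal H}\nabla_{\mathrm{pr}_{\mathcal H}A}\mathrm{pr}_{\mathcal H}Z+\mathrm{pr}_{\mathcal V}\nabla_{\mathrm{pr}_{\mathcal V}A}\mathrm{pr}_{\mathcal V}Z+\mathrm{pr}_{\mathcal H}[\mathrm{pr}_{\mathcal V}A,\mathrm{pr}_{\mathcal H}Z]+\mathrm{pr}_{\mathcal V}[\mathrm{pr}_{\mathcal H}A,\mathrm{pr}_{\mathcal V}Z].$$ The co-metrics $\mathbf h^*,\mathbf v^*$ are the positive semi-definite sections of $\mathrm{Sym}^2TM$ dual to $\mathbf h,\mathbf v$ (extended by zero on the annihilators of $\mathcal H$ and $\mathcal V$ respectively), so $\mathbf g^*=\mathbf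 h^*+\mathbf v^*$. For a section $\mathbf s^*$ of $\mathrm{Sym}^2TM$, $\Gamma^{\mathbf s^*}(f,g)=\mathbf s^*(df,dg)$ and $\Gamma^{\mathbf s^*}(f)=\Gamma^{\mathbf s^*}(f,f)$. *)

theory Defs
  imports "HOL-Analysis.Analysis" "HOL-Library.Function_Algebras"
begin

instantiation "fun" :: (type, real_vector) real_vector
begin

definition scaleR_fun_def: "c *\<^sub>R f = (\<lambda>x. c *\<^sub>R f x)"

instance
  by standard (auto simp: scaleR_fun_def fun_eq_iff scaleR_add_right scaleR_add_left)

end

text \<open>The constants \<open>Ck_on\<close> and \<open>smooth_on\<close> are meant for open sets \<open>S\<close>.\<close>

primrec Ck_on ::
  "nat \<Rightarrow> 'a::euclidean_space set \<Rightarrow> ('a \<Rightarrow> 'b::real_normed_vector) \<Rightarrow> bool" where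
  "Ck_on 0 S f \<longleftrightarrow> continuous_on S f"
| "Ck_on (Suc k) S f \<longleftrightarrow>
     (\<forall>x\<in>S. f differentiable (at x)) \<and>
     (\<forall>v. Ck_on k S (\<lambda>x. frechet_derivative f (at x) v))"

definition smooth_on ::
  "'a::euclidean_space set \<Rightarrow> ('a \<Rightarrow> 'b::real_normed_vector) \<Rightarrow> bool" where
  "smooth_on S f \<longleftrightarrow> (\<forall>k. Ck_on k S f)"

text \<open>
  The manifold is the whole type \<open>'m\<close> with its topology, and its dimension is \<open>DIM('e)\<close>.
  Any atlas of the smooth structure may be given; it need not be maximal. A chart \<open>(U, \<phi>)\<close>
  uses only the values of \<open>\<phi>\<close> on \<open>U\<close>.
\<close>

type_synonym ('m, 'e) atlas = "('m set \<times> ('m \<Rightarrow> 'e)) set"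

definition smooth_atlas :: "('m::topological_space, 'e::euclidean_space) atlas \<Rightarrow> bool" where
  "smooth_atlas \<A> \<longleftrightarrow>
     (\<Union>(U, \<phi>)\<in>\<A>. U) = UNIV \<and>
     (\<forall>(U, \<phi>)\<in>\<A>. open U \<and> open (\<phi> ` U) \<and> homeomorphism U (\<phi> ` U) \<phi> (inv_into U \<phi>)) \<and>
     (\<forall>(U, \<phi>)\<in>\<A>. \<forall>(W, \<psi>)\<in>\<A>. smooth_on (\<phi> ` (U \<inter> W)) (\<psi> \<circ> inv_into U \<phi>))"

definition smooth_funs :: "('m::topological_space, 'e::euclidean_space) atlas \<Rightarrow> ('m \<Rightarrow> real) set" where
  "smooth_funs \<A> = {f. \<forall>(U, \<phi>)\<in>\<A>. smooth_on (\<phi> ` U) (f \<circ> inv_into U \<phi>)}"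

text \<open>
  Tangent vectors at \<open>p\<close> are the derivations at \<open>p\<close> of the algebra of smooth functions, set to
  zero on functions that are not smooth, so that a derivation is determined by its values on
  smooth functions.
\<close>

type_synonym 'm tvec = "('m \<Rightarrow> real) \<Rightarrow> real"

definition tangent_space ::
  "('m::topological_space, 'e::euclidean_space) atlas \<Rightarrow> 'm \<Rightarrow> 'm tvec set" where
  "tangent_space \<A> p = {v.
     (\<forall>f\<in>smooth_funs \<A>. \<forall>g\<in>smooth_funs \<A>. v (f + g) = v f + v g) \<and>
     (\<forall>c. \<forall>f\<in>smooth_funs \<A>. v (c *\<^sub>R f) = c * v f) \<and>
     (\<forall>f\<in>smooth_funs \<A>. \<forall>g\<in>smooth_funs \<A>. v (f * g) = f p * v g + g p * v f) \<and>
     (\<forall>f. f \<notin> smooth_funs \<A> \<longrightarrow> v f = 0)}"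

type_synonym 'm vfield = "'m \<Rightarrow> 'm tvec"

definition vector_fields ::
  "('m::topological_space, 'e::euclidean_space) atlas \<Rightarrow> 'm vfield set" where
  "vector_fields \<A> = {X. (\<forall>p. X p \<in> tangent_space \<A> p) \<and>
     (\<forall>f\<in>smooth_funs \<A>. (\<lambda>p. X p f) \<in> smooth_funs \<A>)}"

definition lie_bracket :: "'m vfield \<Rightarrow> 'm vfield \<Rightarrow> 'm vfield" where
  "lie_bracket X Y = (\<lambda>p f. X p (\<lambda>q. Y q f) - Y p (\<lambda>q. X q f))"

text \<open>Covectors at \<open>p\<close> are set to zero outside the tangent space at \<open>p\<close>.\<close>

type_synonym 'm covec = "'m tvec \<Rightarrow> real"

definition cotangent_space ::
  "('m::topological_space, 'e::euclidean_space) atlas \<Rightarrow> 'm \<Rightarrow> 'm covec set" where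
  "cotangent_space \<A> p = {\<alpha>.
     (\<forall>u\<in>tangent_space \<A> p. \<forall>v\<in>tangent_space \<A> p. \<alpha> (u + v) = \<alpha> u + \<alpha> v) \<and>
     (\<forall>c. \<forall>v\<in>tangent_space \<A> p. \<alpha> (c *\<^sub>R v) = c * \<alpha> v) \<and>
     (\<forall>v. v \<notin> tangent_space \<A> p \<longrightarrow> \<alpha> v = 0)}"

definition one_forms ::
  "('m::topological_space, 'e::euclidean_space) atlas \<Rightarrow> ('m \<Rightarrow> 'm covec) set" where
  "one_forms \<A> = {\<alpha>. (\<forall>p. \<alpha> p \<in> cotangent_space \<A> p) \<and>
     (\<forall>X\<in>vector_fields \<A>. (\<lambda>p. \<alpha> p (X p)) \<in> smooth_funs \<A>)}"

definition differential ::
  "('m::topological_space, 'e::euclidean_space) atlas \<Rightarrow> ('m \<Rightarrow> real) \<Rightarrow> 'm \<Rightarrow> 'm covec" where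
  "differential \<A> f p = (\<lambda>v. if v \<in> tangent_space \<A> p then v f else 0)"

type_synonym 'm metric_field = "'m \<Rightarrow> 'm tvec \<Rightarrow> 'm tvec \<Rightarrow> real"

definition riemannian_metric ::
  "('m::topological_space, 'e::euclidean_space) atlas \<Rightarrow> 'm metric_field \<Rightarrow> bool" where
  "riemannian_metric \<A> g \<longleftrightarrow>
     (\<forall>p. \<forall>u\<in>tangent_space \<A> p. \<forall>v\<in>tangent_space \<A> p. g p u v = g p v u) \<and>
     (\<forall>p. \<forall>u\<in>tangent_space \<A> p. \<forall>v\<in>tangent_space \<A> p. \<forall>w\<in>tangent_space \<A> p.
        g p (u + v) w = g p u w + g p v w) \<and>
     (\<forall>p c. \<forall>u\<in>tangent_space \<A> p. \<forall>w\<in>tangent_space \<A> p. g p (c *\<^sub>R u) w = c * g p u w) \<and>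
     (\<forall>p. \<forall>u\<in>tangent_space \<A> p. u \<noteq> 0 \<longrightarrow> 0 < g p u u) \<and>
     (\<forall>X\<in>vector_fields \<A>. \<forall>Y\<in>vector_fields \<A>. (\<lambda>p. g p (X p) (Y p)) \<in> smooth_funs \<A>)"

text \<open>
  Local frames are restrictions of globally defined vector fields; this is no loss, since a local
  frame can be multiplied by a bump function. The rank is locally constant, hence constant
  on a connected manifold.
\<close>

definition smooth_subbundle ::
  "('m::topological_space, 'e::euclidean_space) atlas \<Rightarrow> ('m \<Rightarrow> 'm tvec set) \<Rightarrow> bool" where
  "smooth_subbundle \<A> D \<longleftrightarrow>
     (\<forall>p. \<exists>U k (E :: nat \<Rightarrow> 'm vfield). open U \<and> p \<in> U \<and> (\<forall>i<k. E i \<in> vector_fields \<A>) \<and>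
        (\<forall>q\<in>U. inj_on (\<lambda>i. E i q) {..<k} \<and> independent ((\<lambda>i. E i q) ` {..<k}) \<and>
               span ((\<lambda>i. E i q) ` {..<k}) = D q))"

definition orthogonal_splitting ::
  "('m::topological_space, 'e::euclidean_space) atlas \<Rightarrow> 'm metric_field \<Rightarrow>
     ('m \<Rightarrow> 'm tvec set) \<Rightarrow> ('m \<Rightarrow> 'm tvec set) \<Rightarrow> bool" where
  "orthogonal_splitting \<A> g H V \<longleftrightarrow>
     smooth_subbundle \<A> H \<and> smooth_subbundle \<A> V \<and>
     (\<forall>p. {u + w | u w. u \<in> H p \<and> w \<in> V p} = tangent_space \<A> p \<and> H p \<inter> V p = {0}) \<and>
     (\<forall>p. \<forall>u\<in>H p. \<forall>w\<in>V p. g p u w = 0)"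

definition orth_proj ::
  "'m metric_field \<Rightarrow> ('m \<Rightarrow> 'm tvec set) \<Rightarrow> 'm \<Rightarrow> 'm tvec \<Rightarrow> 'm tvec" where
  "orth_proj g D p v = (THE u. u \<in> D p \<and> (\<forall>w\<in>D p. g p (v - u) w = 0))"

definition pr ::
  "'m metric_field \<Rightarrow> ('m \<Rightarrow> 'm tvec set) \<Rightarrow> 'm vfield \<Rightarrow> 'm vfield" where
  "pr g D X = (\<lambda>p. orth_proj g D p (X p))"

type_synonym 'm connection = "'m vfield \<Rightarrow> 'm vfield \<Rightarrow> 'm vfield"

definition affine_connection ::
  "('m::topological_space, 'e::euclidean_space) atlas \<Rightarrow> 'm connection \<Rightarrow> bool" where
  "affine_connection \<A> nabla \<longleftrightarrow>
     (\<forall>X\<in>vector_fields \<A>. \<forall>Y\<in>vector_fields \<A>. nabla X Y \<in> vector_fields \<A>) \<and>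
     (\<forall>X\<in>vector_fields \<A>. \<forall>Y\<in>vector_fields \<A>. \<forall>Z\<in>vector_fields \<A>.
        nabla (X + Y) Z = nabla X Z + nabla Y Z \<and> nabla X (Y + Z) = nabla X Y + nabla X Z) \<and>
     (\<forall>f\<in>smooth_funs \<A>. \<forall>X\<in>vector_fields \<A>. \<forall>Y\<in>vector_fields \<A>.
        nabla (\<lambda>p. f p *\<^sub>R X p) Y = (\<lambda>p. f p *\<^sub>R nabla X Y p) \<and>
        nabla X (\<lambda>p. f p *\<^sub>R Y p) = (\<lambda>p. X p f *\<^sub>R Y p + f p *\<^sub>R nabla X Y p))"

definition levi_civita ::
  "('m::topological_space, 'e::euclidean_space) atlas \<Rightarrow> 'm metric_field \<Rightarrow> 'm connection \<Rightarrow> bool" where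
  "levi_civita \<A> g nabla \<longleftrightarrow> affine_connection \<A> nabla \<and>
     (\<forall>X\<in>vector_fields \<A>. \<forall>Y\<in>vector_fields \<A>. \<forall>Z\<in>vector_fields \<A>. \<forall>p.
        X p (\<lambda>q. g q (Y q) (Z q)) = g p (nabla X Y p) (Z p) + g p (Y p) (nabla X Z p)) \<and>
     (\<forall>X\<in>vector_fields \<A>. \<forall>Y\<in>vector_fields \<A>. nabla X Y - nabla Y X = lie_bracket X Y)"

definition ring_nabla ::
  "'m metric_field \<Rightarrow> ('m \<Rightarrow> 'm tvec set) \<Rightarrow> ('m \<Rightarrow> 'm tvec set) \<Rightarrow> 'm connection \<Rightarrow> 'm connection" where
  "ring_nabla g H V nabla A Z =
     pr g H (nabla (pr g H A) (pr g H Z)) + pr g V (nabla (pr g V A) (pr g V Z)) +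
     pr g H (lie_bracket (pr g V A) (pr g H Z)) + pr g V (lie_bracket (pr g H A) (pr g V Z))"

text \<open>
  Sections of \<open>Sym\<^sup>2 TM\<close> are given by their values on pairs of covectors. The co-metric of
  the restriction of \<open>g\<close> to \<open>D\<close> is \<open>(\<alpha>, \<beta>) \<mapsto> g (sharp \<alpha>) (sharp \<beta>)\<close>, where \<open>sharp \<alpha>\<close> is the
  element of \<open>D\<close> representing the restriction of \<open>\<alpha>\<close> to \<open>D\<close>; it vanishes on the annihilator
  of \<open>D\<close>.
\<close>

type_synonym 'm bivector = "'m \<Rightarrow> 'm covec \<Rightarrow> 'm covec \<Rightarrow> real"

definition sharp ::
  "'m metric_field \<Rightarrow> ('m \<Rightarrow> 'm tvec set) \<Rightarrow> 'm \<Rightarrow> 'm covec \<Rightarrow> 'm tvec" where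
  "sharp g D p \<alpha> = (THE u. u \<in> D p \<and> (\<forall>w\<in>D p. g p u w = \<alpha> w))"

definition cometric :: "'m metric_field \<Rightarrow> ('m \<Rightarrow> 'm tvec set) \<Rightarrow> 'm bivector" where
  "cometric g D p \<alpha> \<beta> = g p (sharp g D p \<alpha>) (sharp g D p \<beta>)"

definition Gam ::
  "('m::topological_space, 'e::euclidean_space) atlas \<Rightarrow> 'm bivector \<Rightarrow>
     ('m \<Rightarrow> real) \<Rightarrow> ('m \<Rightarrow> real) \<Rightarrow> 'm \<Rightarrow> real" where
  "Gam \<A> s f g = (\<lambda>p. s p (differential \<A> f p) (differential \<A> g p))"

definition nabla_form ::
  "('m::topological_space, 'e::euclidean_space) atlas \<Rightarrow> 'm connection \<Rightarrow> 'm vfield \<Rightarrow>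
     ('m \<Rightarrow> 'm covec) \<Rightarrow> ('m \<Rightarrow> 'm covec)" where
  "nabla_form \<A> nabla A \<alpha> = (THE \<omega>. \<omega> \<in> one_forms \<A> \<and>
     (\<forall>Z\<in>vector_fields \<A>. \<forall>p. \<omega> p (Z p) = A p (\<lambda>q. \<alpha> q (Z q)) - \<alpha> p (nabla A Z p)))"

definition nabla_bivector ::
  "('m::topological_space, 'e::euclidean_space) atlas \<Rightarrow> 'm connection \<Rightarrow> 'm bivector \<Rightarrow> 'm vfield \<Rightarrow>
     ('m \<Rightarrow> 'm covec) \<Rightarrow> ('m \<Rightarrow> 'm covec) \<Rightarrow> 'm \<Rightarrow> real" where
  "nabla_bivector \<A> nabla s A \<alpha> \<beta> = (\<lambda>p.
     A p (\<lambda>q. s q (\<alpha> q) (\<beta> q)) -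
     s p (nabla_form \<A> nabla A \<alpha> p) (\<beta> p) - s p (\<alpha> p) (nabla_form \<A> nabla A \<beta> p))"

definition parallel ::
  "('m::topological_space, 'e::euclidean_space) atlas \<Rightarrow> 'm connection \<Rightarrow> 'm bivector \<Rightarrow> bool" where
  "parallel \<A> nabla s \<longleftrightarrow> (\<forall>A\<in>vector_fields \<A>. \<forall>\<alpha>\<in>one_forms \<A>. \<forall>\<beta>\<in>one_forms \<A>.
     nabla_bivector \<A> nabla s A \<alpha> \<beta> = 0)"

end

theory Submission
  imports Defs
begin

text \<open>
  For a function \<open>f\<close> let \<open>x\<close> and \<open>z\<close> be the components of its gradient in \<open>H\<close> and \<open>V\<close>, so that
  \<open>\<Gamma>\<^sup>h(f, \<Gamma>\<^sup>v(f)) = x g(z, z)\<close> and \<open>\<Gamma>\<^sup>v(f, \<Gamma>\<^sup>h(f)) = z g(x, x)\<close>. Both sides involve second derivatives of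
  \<open>f\<close>, but their difference does not: from \<open>x g(z, z) - z g(x, x) = [x, z] f = g([x, z], x + z)\<close> and
  the definition of the Lie derivative one finds (\<open>Gam_commutator\<close>)
  \<open>\<Gamma>\<^sup>h(f, \<Gamma>\<^sup>v(f)) - \<Gamma>\<^sup>v(f, \<Gamma>\<^sup>h(f)) = (L\<^sub>z g)(x, x) - (L\<^sub>x g)(z, z)\<close>.

  For \<open>X\<close> in \<open>H\<close> and \<open>a, b\<close> in \<open>V\<close>, orthogonality of the splitting makes \<open>(L\<^sub>X g)(a, b)\<close> tensorial in all three
  arguments (\<open>lie_metric_pointwise\<close>), and likewise with \<open>H\<close> and \<open>V\<close> exchanged. A smooth function
  may have any prescribed differential at a point (\<open>covector_is_differential\<close>). So the operators
  commute if and only if \<open>(L\<^sub>X g)(a, a) = (L\<^sub>a g)(X, X)\<close> for all \<open>X\<close> in \<open>H\<close> and \<open>a\<close> in \<open>V\<close>. One side is linear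
  and the other quadratic in \<open>X\<close>, so both are zero; by polarization, \<open>L\<^sub>X g\<close> vanishes on \<open>V\<close> for \<open>X\<close> in
  \<open>H\<close>, and \<open>L\<^sub>a g\<close> vanishes on \<open>H\<close> for \<open>a\<close> in \<open>V\<close> (\<open>Gam_commute_iff_preserved\<close>).

  These two conditions say that the co-metrics are parallel (\<open>parallel_iff_preserved\<close>): along \<open>V\<close> the
  connection differentiates sections of \<open>V\<close> by the projected Levi-Civita connection, which is metric,
  and along \<open>H\<close> by the projected bracket, whose failure to be metric is exactly \<open>(L\<^sub>X g)(a, b)\<close>.

  Everything happens in frames made of global vector fields, which the definition of a smooth
  subbundle supplies. Two steps carry the differential geometry. A Gram-Schmidt process
  without division (\<open>gram_schmidt_fields\<close>) yields smooth frames, and from them smooth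
  projections and gradients. The product of the squared lengths of such a frame, cut off where the
  dimension changes, serves as a bump function in the proof that \<open>C\<^sup>\<infinity>\<close>-linear maps are pointwise
  (\<open>global_expansion\<close>, \<open>tensorial_cong\<close>), which is also what makes the covariant derivative of a
  one-form exist.
\<close>

section \<open>Calculus of \<open>C\<^sup>k\<close> functions\<close>

lemma Ck_on_Suc_imp: "Ck_on (Suc k) S f \<Longrightarrow> Ck_on k S f"
proof (induction k arbitrary: f)
  case 0
  then show ?case
    by (auto intro!: differentiable_imp_continuous_on differentiable_at_imp_differentiable_on)
next
  case (Suc k)
  then show ?case by (metis Ck_on.simps(2))
qed

text \<open>
  Openness of \<open>S\<close> matters here: the derivatives in \<open>Ck_on\<close> are taken in the full space, so two
  functions must agree in a neighbourhood of each point.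
\<close>

lemma Ck_on_cong:
  assumes "open S" "\<And>x. x \<in> S \<Longrightarrow> f x = h x"
  shows "Ck_on k S f \<longleftrightarrow> Ck_on k S h"
  using assms(2)
proof (induction k arbitrary: f h)
  case 0
  then show ?case by (auto intro: continuous_on_cong[THEN iffD1])
next
  case (Suc k)
  have d: "(f has_derivative D) (at x) \<longleftrightarrow> (h has_derivative D) (at x)" if "x \<in> S" for x D
    using has_derivative_transform_within_open[OF _ \<open>open S\<close> that] Suc.prems by metis
  have "frechet_derivative f (at x) = frechet_derivative h (at x)" if "x \<in> S" for x
    unfolding frechet_derivative_def using d[OF that] by simp
  then have "Ck_on k S (\<lambda>x. frechet_derivative f (at x) v) \<longleftrightarrow>
      Ck_on k S (\<lambda>x. frechet_derivative h (at x) v)" for v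
    by (intro Suc.IH) auto
  moreover have "f differentiable (at x) \<longleftrightarrow> h differentiable (at x)" if "x \<in> S" for x
    using d[OF that] by (auto simp: differentiable_def)
  ultimately show ?case by auto
qed

lemma Ck_on_subset: "Ck_on k S f \<Longrightarrow> T \<subseteq> S \<Longrightarrow> Ck_on k T f"
  by (induction k arbitrary: f) (auto intro: continuous_on_subset)

lemma Ck_on_local:
  assumes "\<And>x. x \<in> S \<Longrightarrow> \<exists>T. open T \<and> x \<in> T \<and> Ck_on k T f"
  shows "Ck_on k S f"
  using assms
proof (induction k arbitrary: f)
  case 0
  then show ?case
    by (metis Ck_on.simps(1) continuous_at_imp_continuous_on continuous_on_eq_continuous_at)
next
  case (Suc k)
  show ?case
    unfolding Ck_on.simps
  proof (intro conjI allI ballI Suc.IH)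
    fix x assume "x \<in> S"
    then obtain T where T: "open T" "x \<in> T" "Ck_on (Suc k) T f" using Suc.prems by blast
    then show "f differentiable at x" by simp
    fix v
    show "\<exists>T. open T \<and> x \<in> T \<and> Ck_on k T (\<lambda>x. frechet_derivative f (at x) v)"
      using T by auto
  qed
qed

lemma Ck_on_const: "Ck_on k S (\<lambda>x. c)"
  by (induction k arbitrary: c) auto

lemma Ck_on_add:
  assumes "open S" "Ck_on k S f" "Ck_on k S h"
  shows "Ck_on k S (\<lambda>x. f x + h x)"
  using assms(2,3)
proof (induction k arbitrary: f h)
  case 0
  then show ?case by (auto intro: continuous_on_add)
next
  case (Suc k)
  have "Ck_on k S (\<lambda>x. frechet_derivative f (at x) v + frechet_derivative h (at x) v)" for v
    using Suc by auto
  moreover have "frechet_derivative (\<lambda>x. f x + h x) (at x) v =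
      frechet_derivative f (at x) v + frechet_derivative h (at x) v" if "x \<in> S" for x v
    using Suc.prems that
    by (subst frechet_derivative_at[symmetric, OF has_derivative_add])
      (auto simp: frechet_derivative_works)
  ultimately have "Ck_on k S (\<lambda>x. frechet_derivative (\<lambda>x. f x + h x) (at x) v)" for v
    using Ck_on_cong[OF assms(1)] by (metis (no_types, lifting))
  then show ?case using Suc.prems by auto
qed

lemma Ck_on_mult:
  fixes f h :: "'a::euclidean_space \<Rightarrow> real"
  assumes "open S" "Ck_on k S f" "Ck_on k S h"
  shows "Ck_on k S (\<lambda>x. f x * h x)"
  using assms(2,3)
proof (induction k arbitrary: f h)
  case 0
  then show ?case by (auto intro: continuous_on_mult)
next
  case (Suc k)
  have "Ck_on k S (\<lambda>x. f x * frechet_derivative h (at x) v + frechet_derivative f (at x) v * h x)" for v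
    using Suc.prems Suc.prems[THEN Ck_on_Suc_imp] by (intro Ck_on_add[OF assms(1)] Suc.IH) auto
  moreover have "frechet_derivative (\<lambda>x. f x * h x) (at x) v =
      f x * frechet_derivative h (at x) v + frechet_derivative f (at x) v * h x" if "x \<in> S" for x v
    using Suc.prems that
    by (subst frechet_derivative_at[symmetric, OF has_derivative_mult])
      (auto simp: frechet_derivative_works)
  ultimately have "Ck_on k S (\<lambda>x. frechet_derivative (\<lambda>x. f x * h x) (at x) v)" for v
    using Ck_on_cong[OF assms(1)] by (metis (no_types, lifting))
  then show ?case using Suc.prems by auto
qed

lemma Ck_on_inverse:
  fixes f :: "'a::euclidean_space \<Rightarrow> real"
  assumes "open S" "\<And>x. x \<in> S \<Longrightarrow> f x \<noteq> 0" "Ck_on k S f"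
  shows "Ck_on k S (\<lambda>x. inverse (f x))"
  using assms(3)
proof (induction k)
  case 0
  then show ?case using assms(2) by (auto intro: continuous_on_inverse)
next
  case (Suc k)
  have d: "((\<lambda>x. inverse (f x)) has_derivative
      (\<lambda>v. (-1) * (inverse (f x) * (frechet_derivative f (at x) v * inverse (f x))))) (at x)"
    if "x \<in> S" for x
  proof -
    have "(f has_derivative frechet_derivative f (at x)) (at x)"
      using Suc.prems that by (simp add: frechet_derivative_works)
    from Deriv.has_derivative_inverse[OF assms(2)[OF that] this] show ?thesis
      by (simp add: mult_ac)
  qed
  have "Ck_on k S (\<lambda>x. (-1) * (inverse (f x) * (frechet_derivative f (at x) v * inverse (f x))))" for v
    using Suc.prems Suc.IH[OF Ck_on_Suc_imp[OF Suc.prems]]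
    by (intro Ck_on_mult assms(1) Ck_on_const) auto
  then have "Ck_on k S (\<lambda>x. frechet_derivative (\<lambda>x. inverse (f x)) (at x) v)" for v
    using Ck_on_cong[OF assms(1)] frechet_derivative_at[OF d, symmetric] by (metis (no_types, lifting))
  then show ?case using d by (auto simp: differentiable_def)
qed

section \<open>Smooth functions on open subsets of a manifold\<close>

definition smooth_funs_on ::
  "('m::topological_space, 'e::euclidean_space) atlas \<Rightarrow> 'm set \<Rightarrow> ('m \<Rightarrow> real) set" where
  "smooth_funs_on \<A> U = {f. \<forall>(W, \<phi>)\<in>\<A>. smooth_on (\<phi> ` (W \<inter> U)) (f \<circ> inv_into W \<phi>)}"

locale manifold =
  fixes \<A> :: "('m::topological_space, 'e::euclidean_space) atlas"
  assumes atlas: "smooth_atlas \<A>"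
begin

lemma chart:
  assumes "(W, \<phi>) \<in> \<A>"
  shows "open W" "inj_on \<phi> W" "open U \<Longrightarrow> open (\<phi> ` (W \<inter> U))"
proof -
  have W: "open W" "open (\<phi> ` W)" "homeomorphism W (\<phi> ` W) \<phi> (inv_into W \<phi>)"
    using atlas assms unfolding smooth_atlas_def by auto
  show "open W" by fact
  show "inj_on \<phi> W" using W(3) unfolding homeomorphism_def by (metis inj_on_inverseI)
  show "open (\<phi> ` (W \<inter> U))" if "open U"
  proof -
    have "openin (top_of_set (\<phi> ` W)) (\<phi> ` (W \<inter> U))"
      by (rule homeomorphism_imp_open_map[OF W(3)]) (use that in auto)
    then show ?thesis using W(2) openin_open_trans by blast
  qed
qed

lemma smooth_funs_on_UNIV: "smooth_funs_on \<A> UNIV = smooth_funs \<A>"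
  by (simp add: smooth_funs_on_def smooth_funs_def)

lemma smooth_funs_on_cong:
  assumes "open U" "\<And>q. q \<in> U \<Longrightarrow> f q = h q" "f \<in> smooth_funs_on \<A> U"
  shows "h \<in> smooth_funs_on \<A> U"
  unfolding smooth_funs_on_def
proof (clarify)
  fix W \<phi> assume W: "(W, \<phi>) \<in> \<A>"
  have "Ck_on k (\<phi> ` (W \<inter> U)) (h \<circ> inv_into W \<phi>)" for k
  proof (rule Ck_on_cong[THEN iffD1])
    show "open (\<phi> ` (W \<inter> U))" by (rule chart(3)[OF W assms(1)])
    show "(f \<circ> inv_into W \<phi>) x = (h \<circ> inv_into W \<phi>) x" if "x \<in> \<phi> ` (W \<inter> U)" for x
      using that assms(2) chart(2)[OF W] by auto
    show "Ck_on k (\<phi> ` (W \<inter> U)) (f \<circ> inv_into W \<phi>)"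
      using assms(3) W by (auto simp: smooth_funs_on_def smooth_on_def)
  qed
  then show "smooth_on (\<phi> ` (W \<inter> U)) (h \<circ> inv_into W \<phi>)" by (simp add: smooth_on_def)
qed

lemma smooth_funs_on_const: "(\<lambda>q. c) \<in> smooth_funs_on \<A> U"
  by (auto simp: smooth_funs_on_def smooth_on_def o_def Ck_on_const)

lemma smooth_funs_on_add:
  "open U \<Longrightarrow> f \<in> smooth_funs_on \<A> U \<Longrightarrow> h \<in> smooth_funs_on \<A> U \<Longrightarrow> (\<lambda>q. f q + h q) \<in> smooth_funs_on \<A> U"
  using chart(3) by (fastforce simp: smooth_funs_on_def smooth_on_def o_def intro!: Ck_on_add)

lemma smooth_funs_on_mult:
  "open U \<Longrightarrow> f \<in> smooth_funs_on \<A> U \<Longrightarrow> h \<in> smooth_funs_on \<A> U \<Longrightarrow> (\<lambda>q. f q * h q) \<in> smooth_funs_on \<A> U"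
  using chart(3) by (fastforce simp: smooth_funs_on_def smooth_on_def o_def intro!: Ck_on_mult)

lemma smooth_funs_on_inverse:
  assumes "open U" "f \<in> smooth_funs_on \<A> U" "\<And>q. q \<in> U \<Longrightarrow> f q \<noteq> 0"
  shows "(\<lambda>q. inverse (f q)) \<in> smooth_funs_on \<A> U"
  unfolding smooth_funs_on_def
proof (clarify)
  fix W \<phi> assume W: "(W, \<phi>) \<in> \<A>"
  have "Ck_on k (\<phi> ` (W \<inter> U)) (\<lambda>x. inverse (f (inv_into W \<phi> x)))" for k
    using chart[OF W] assms W
    by (intro Ck_on_inverse) (auto simp: smooth_funs_on_def smooth_on_def o_def)
  then show "smooth_on (\<phi> ` (W \<inter> U)) ((\<lambda>q. inverse (f q)) \<circ> inv_into W \<phi>)"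
    by (simp add: smooth_on_def o_def)
qed

lemma smooth_funs_on_sum:
  assumes "open U" "\<And>i. i < (k::nat) \<Longrightarrow> f i \<in> smooth_funs_on \<A> U"
  shows "(\<lambda>q. \<Sum>i<k. f i q) \<in> smooth_funs_on \<A> U"
  using assms(2)
  by (induction k) (auto simp: smooth_funs_on_const intro!: smooth_funs_on_add[OF assms(1)])

lemma smooth_funs_on_mono: "f \<in> smooth_funs_on \<A> U \<Longrightarrow> U' \<subseteq> U \<Longrightarrow> f \<in> smooth_funs_on \<A> U'"
  unfolding smooth_funs_on_def smooth_on_def
  by (fastforce elim: Ck_on_subset)

lemma smooth_funs_restrict: "f \<in> smooth_funs \<A> \<Longrightarrow> f \<in> smooth_funs_on \<A> U"
  using smooth_funs_on_mono smooth_funs_on_UNIV by blast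

text \<open>
  Smoothness is local. This is what turns formulas in a local frame, with denominators that vanish
  elsewhere, into globally smooth objects.
\<close>

lemma smooth_funs_local:
  assumes "\<And>p. \<exists>U. open U \<and> p \<in> U \<and> f \<in> smooth_funs_on \<A> U"
  shows "f \<in> smooth_funs \<A>"
proof -
  have "Ck_on k (\<phi> ` W) (f \<circ> inv_into W \<phi>)" if W: "(W, \<phi>) \<in> \<A>" for W \<phi> k
  proof (rule Ck_on_local)
    fix x assume "x \<in> \<phi> ` W"
    then obtain p where p: "p \<in> W" "x = \<phi> p" by blast
    obtain U where U: "open U" "p \<in> U" "f \<in> smooth_funs_on \<A> U" using assms by blast
    show "\<exists>T. open T \<and> x \<in> T \<and> Ck_on k T (f \<circ> inv_into W \<phi>)"
      by (rule exI[of _ "\<phi> ` (W \<inter> U)"])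
        (use U p W chart(3)[OF W] in \<open>auto simp: smooth_funs_on_def smooth_on_def\<close>)
  qed
  then show ?thesis by (auto simp: smooth_funs_def smooth_on_def)
qed

lemmas smooth_const = smooth_funs_on_const[where U = UNIV, unfolded smooth_funs_on_UNIV]
lemmas smooth_add = smooth_funs_on_add[where U = UNIV, unfolded smooth_funs_on_UNIV, OF open_UNIV]
lemmas smooth_mult = smooth_funs_on_mult[where U = UNIV, unfolded smooth_funs_on_UNIV, OF open_UNIV]
lemmas smooth_sum = smooth_funs_on_sum[where U = UNIV, unfolded smooth_funs_on_UNIV, OF open_UNIV]

lemma smooth_prod:
  assumes "\<And>i. i \<in> I \<Longrightarrow> f i \<in> smooth_funs \<A>"
  shows "(\<lambda>q. \<Prod>i\<in>I. f i q) \<in> smooth_funs \<A>"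
  using assms
  by (induction I rule: infinite_finite_induct) (auto intro!: smooth_const smooth_mult)

lemma smooth_diff:
  "f \<in> smooth_funs \<A> \<Longrightarrow> h \<in> smooth_funs \<A> \<Longrightarrow> (\<lambda>q. f q - h q) \<in> smooth_funs \<A>"
  using smooth_add[of f "\<lambda>q. (-1) * h q"] smooth_mult[OF smooth_const, of h "-1"] by simp

end

section \<open>Tangent vectors and vector fields\<close>

context manifold
begin

abbreviation "T \<equiv> tangent_space \<A>"

lemma tangent_add: "v \<in> T p \<Longrightarrow> f \<in> smooth_funs \<A> \<Longrightarrow> h \<in> smooth_funs \<A> \<Longrightarrow>
    v (\<lambda>q. f q + h q) = v f + v h"
  by (simp add: tangent_space_def plus_fun_def)

lemma tangent_cmult: "v \<in> T p \<Longrightarrow> f \<in> smooth_funs \<A> \<Longrightarrow> v (\<lambda>q. c * f q) = c * v f"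
  by (auto simp: tangent_space_def scaleR_fun_def)

lemma tangent_mult: "v \<in> T p \<Longrightarrow> f \<in> smooth_funs \<A> \<Longrightarrow> h \<in> smooth_funs \<A> \<Longrightarrow>
    v (\<lambda>q. f q * h q) = f p * v h + h p * v f"
  by (simp add: tangent_space_def times_fun_def)

lemma tangent_diff: "v \<in> T p \<Longrightarrow> f \<in> smooth_funs \<A> \<Longrightarrow> h \<in> smooth_funs \<A> \<Longrightarrow>
    v (\<lambda>q. f q - h q) = v f - v h"
  using tangent_add[of v p f "\<lambda>q. (-1) * h q"] tangent_cmult[of v p h "-1"]
    smooth_mult[OF smooth_const, of h "-1"] by simp

lemma tangent_zero_fun: "v \<in> T p \<Longrightarrow> v (\<lambda>q. 0) = 0"
  using tangent_cmult[of v p "\<lambda>q. 0" 0] smooth_const by simp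

lemma tangent_not_smooth: "v \<in> T p \<Longrightarrow> f \<notin> smooth_funs \<A> \<Longrightarrow> v f = 0"
  by (simp add: tangent_space_def)

lemma subspace_tangent: "subspace (T p)"
proof (rule subspaceI)
  show "0 \<in> T p" by (simp add: tangent_space_def)
  show "u + v \<in> T p" if "u \<in> T p" "v \<in> T p" for u v
    using that by (simp add: tangent_space_def algebra_simps)
  show "c *\<^sub>R u \<in> T p" if "u \<in> T p" for c u
    using that by (simp add: tangent_space_def algebra_simps scaleR_fun_def)
qed

lemmas T_add = subspace_add[OF subspace_tangent]
lemmas T_scale = subspace_scale[OF subspace_tangent]
lemmas T_diff = subspace_diff[OF subspace_tangent]
lemmas T_zero = subspace_0[OF subspace_tangent]
lemmas T_sum = subspace_sum[OF subspace_tangent]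

lemma sum_tvec_apply: "(\<Sum>i\<in>I. c i *\<^sub>R (v i :: 'm tvec)) f = (\<Sum>i\<in>I. c i * v i f)"
  by (induction I rule: infinite_finite_induct) (auto simp: scaleR_fun_def)

lemma tangent_combination:
  assumes "v \<in> T p" "\<And>i. i < (n::nat) \<Longrightarrow> f i \<in> smooth_funs \<A>"
  shows "v (\<lambda>q. \<Sum>i<n. c i * f i q) = (\<Sum>i<n. c i * v (f i))"
  using assms(2)
proof (induction n)
  case 0
  then show ?case using tangent_zero_fun[OF assms(1)] by simp
next
  case (Suc n)
  have "(\<lambda>q. \<Sum>i<n. c i * f i q) \<in> smooth_funs \<A>" "(\<lambda>q. c n * f n q) \<in> smooth_funs \<A>"
    using Suc.prems by (auto intro!: smooth_sum smooth_mult smooth_const)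
  then show ?case
    using Suc tangent_add[OF assms(1)] tangent_cmult[OF assms(1)] by simp
qed

text \<open>
  Linearly independent functionals on a vector space take arbitrary prescribed values at a common
  argument. Tangent vectors at \<open>p\<close> are functionals on the smooth functions, so this provides
  functions with given differential at \<open>p\<close>. In the induction step the new functional would be a
  combination of the previous ones if it vanished on their common kernel: subtract from \<open>f\<close> its
  expansion in a dual family \<open>d\<close>.
\<close>

lemma independent_functionals_attain:
  fixes F :: "nat \<Rightarrow> 'm tvec"
  assumes "inj_on F {..<n}" "independent (F ` {..<n})" "\<And>i. i < n \<Longrightarrow> F i \<in> T p"
  shows "\<exists>f\<in>smooth_funs \<A>. \<forall>i<n. F i f = c i"
  using assms
proof (induction n arbitrary: c)
  case 0
  then show ?case using smooth_const by auto
next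
  case (Suc n)
  have ins: "F ` {..<Suc n} = insert (F n) (F ` {..<n})" by (auto simp: lessThan_Suc)
  have inj: "inj_on F {..<n}" and "F n \<notin> F ` {..<n}"
    using Suc.prems(1) by (auto simp: lessThan_Suc)
  then have ind: "independent (F ` {..<n})" and notin: "F n \<notin> span (F ` {..<n})"
    using Suc.prems(2) unfolding ins independent_insert by auto
  have FT: "\<And>i. i < Suc n \<Longrightarrow> F i \<in> T p" using Suc.prems(3) by auto
  have IH: "\<exists>f\<in>smooth_funs \<A>. \<forall>i<n. F i f = c i" for c
    by (rule Suc.IH[OF inj ind]) (use FT in auto)
  have "\<exists>d. d \<in> smooth_funs \<A> \<and> (\<forall>i<n. F i d = (if i = j then 1 else 0))" for j
    using IH[of "\<lambda>i. if i = j then 1 else 0"] by auto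
  then obtain d where d: "\<And>j. d j \<in> smooth_funs \<A>"
    "\<And>i j. i < n \<Longrightarrow> F i (d j) = (if i = j then 1 else 0)" by metis
  have "\<exists>f\<in>smooth_funs \<A>. (\<forall>i<n. F i f = 0) \<and> F n f \<noteq> 0"
  proof (rule ccontr)
    assume *: "\<not> ?thesis"
    have "F n f = (\<Sum>i<n. F n (d i) *\<^sub>R F i) f" for f
    proof (cases "f \<in> smooth_funs \<A>")
      case False
      then have "F i f = 0" if "i < Suc n" for i using tangent_not_smooth[OF FT[OF that]] by simp
      then show ?thesis by (simp add: sum_tvec_apply)
    next
      case True
      let ?s = "\<lambda>q. \<Sum>i<n. F i f * d i q"
      let ?r = "\<lambda>q. f q - ?s q"
      have s: "?s \<in> smooth_funs \<A>" using d by (auto intro!: smooth_sum smooth_mult smooth_const)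
      have r: "?r \<in> smooth_funs \<A>" by (rule smooth_diff[OF True s])
      have Fr: "F j ?r = F j f - (\<Sum>i<n. F i f * F j (d i))" if "j < Suc n" for j
        using tangent_diff[OF FT[OF that] True s] tangent_combination[OF FT[OF that], of n d] d by simp
      have "F j ?r = 0" if "j < n" for j
        using Fr[of j] that d(2) by (simp add: if_distrib[of "\<lambda>x. _ * x"] cong: if_cong)
      then have "F n ?r = 0" using * r by blast
      then show ?thesis using Fr[of n] by (simp add: sum_tvec_apply mult.commute)
    qed
    then have "F n = (\<Sum>i<n. F n (d i) *\<^sub>R F i)" by blast
    moreover have "(\<Sum>i<n. F n (d i) *\<^sub>R F i) \<in> span (F ` {..<n})"
      by (intro span_sum span_scale span_base) auto
    ultimately show False using notin by simp
  qed
  then obtain e where e: "e \<in> smooth_funs \<A>" "\<And>i. i < n \<Longrightarrow> F i e = 0" "F n e \<noteq> 0" by blast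
  obtain f where f: "f \<in> smooth_funs \<A>" "\<And>i. i < n \<Longrightarrow> F i f = c i" using IH[of c] by blast
  define a where "a = (c n - F n f) / F n e"
  have ae: "(\<lambda>q. a * e q) \<in> smooth_funs \<A>" by (rule smooth_mult[OF smooth_const e(1)])
  have "F i (\<lambda>q. f q + a * e q) = F i f + a * F i e" if "i < Suc n" for i
    using tangent_add[OF FT[OF that] f(1) ae] tangent_cmult[OF FT[OF that] e(1)] by simp
  moreover have "a * F n e = c n - F n f" using e(3) by (simp add: a_def)
  ultimately have "\<forall>i<Suc n. F i (\<lambda>q. f q + a * e q) = c i"
    using e(2) f(2) by (simp add: less_Suc_eq)
  then show ?case using smooth_add[OF f(1) ae] by blast
qed

abbreviation "XX \<equiv> vector_fields \<A>"

lemma field_tangent: "X \<in> XX \<Longrightarrow> X p \<in> T p"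
  by (simp add: vector_fields_def)

lemma field_smooth: "X \<in> XX \<Longrightarrow> f \<in> smooth_funs \<A> \<Longrightarrow> (\<lambda>p. X p f) \<in> smooth_funs \<A>"
  by (simp add: vector_fields_def)

lemma field_add: "X \<in> XX \<Longrightarrow> Y \<in> XX \<Longrightarrow> X + Y \<in> XX"
  by (auto simp: vector_fields_def intro: T_add smooth_add)

lemma field_scale: "f \<in> smooth_funs \<A> \<Longrightarrow> X \<in> XX \<Longrightarrow> (\<lambda>p. f p *\<^sub>R X p) \<in> XX"
  unfolding vector_fields_def
  by (auto intro: T_scale) (simp add: scaleR_fun_def smooth_mult)

lemma field_zero: "(\<lambda>p. 0) \<in> XX" "0 \<in> XX"
  by (auto simp: vector_fields_def zero_fun_def intro: T_zero[unfolded zero_fun_def] smooth_const)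

lemma field_diff: "X \<in> XX \<Longrightarrow> Y \<in> XX \<Longrightarrow> X - Y \<in> XX"
  by (auto simp: vector_fields_def intro: T_diff smooth_diff)

lemma field_sum: "(\<And>i. i \<in> I \<Longrightarrow> X i \<in> XX) \<Longrightarrow> (\<lambda>p. \<Sum>i\<in>I. X i p) \<in> XX"
proof (induction I rule: infinite_finite_induct)
  case (insert i I)
  then have "X i + (\<lambda>p. \<Sum>i\<in>I. X i p) \<in> XX" by (intro field_add) auto
  then show ?case using insert by (simp add: plus_fun_def)
qed (use field_zero in auto)

lemma cotangent_differential: "differential \<A> f p \<in> cotangent_space \<A> p"
  using T_add T_scale by (simp add: cotangent_space_def differential_def scaleR_fun_def)

lemma differential_one_form: "f \<in> smooth_funs \<A> \<Longrightarrow> differential \<A> f \<in> one_forms \<A>"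
  by (simp add: one_forms_def cotangent_differential)
    (simp add: differential_def field_tangent field_smooth)

end

section \<open>Orthogonal families in a tangent space\<close>

locale riemannian_manifold = manifold \<A>
  for \<A> :: "('m::topological_space, 'e::euclidean_space) atlas" +
  fixes g :: "'m metric_field"
  assumes metric: "riemannian_metric \<A> g"
begin

lemma g_sym: "u \<in> T p \<Longrightarrow> v \<in> T p \<Longrightarrow> g p u v = g p v u"
  using metric unfolding riemannian_metric_def by blast

lemma g_add: "u \<in> T p \<Longrightarrow> v \<in> T p \<Longrightarrow> w \<in> T p \<Longrightarrow> g p (u + v) w = g p u w + g p v w"
  using metric unfolding riemannian_metric_def by blast

lemma g_scale: "u \<in> T p \<Longrightarrow> w \<in> T p \<Longrightarrow> g p (c *\<^sub>R u) w = c * g p u w"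
  using metric unfolding riemannian_metric_def by blast

lemma g_add_right: "u \<in> T p \<Longrightarrow> v \<in> T p \<Longrightarrow> w \<in> T p \<Longrightarrow> g p w (u + v) = g p w u + g p w v"
  by (metis T_add g_add g_sym)

lemma g_scale_right: "u \<in> T p \<Longrightarrow> w \<in> T p \<Longrightarrow> g p w (c *\<^sub>R u) = c * g p w u"
  by (metis T_scale g_scale g_sym)

lemma g_zero: "w \<in> T p \<Longrightarrow> g p 0 w = 0" "w \<in> T p \<Longrightarrow> g p w 0 = 0"
  using g_scale[of 0 p w 0] g_scale_right[of 0 p w 0] T_zero by auto

lemma g_diff: "u \<in> T p \<Longrightarrow> v \<in> T p \<Longrightarrow> w \<in> T p \<Longrightarrow> g p (u - v) w = g p u w - g p v w"
  by (metis T_diff add_diff_cancel_right' diff_add_cancel g_add)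

lemma g_diff_right: "u \<in> T p \<Longrightarrow> v \<in> T p \<Longrightarrow> w \<in> T p \<Longrightarrow> g p w (u - v) = g p w u - g p w v"
  by (metis T_diff g_diff g_sym)

lemma g_sum:
  assumes "\<And>i. i \<in> I \<Longrightarrow> v i \<in> T p" "w \<in> T p"
  shows "g p (\<Sum>i\<in>I. c i *\<^sub>R v i) w = (\<Sum>i\<in>I. c i * g p (v i) w)"
  using assms(1)
  by (induction I rule: infinite_finite_induct)
    (auto simp: g_zero assms(2) g_add g_scale T_scale T_sum)

lemma g_pos: "u \<in> T p \<Longrightarrow> u \<noteq> 0 \<Longrightarrow> 0 < g p u u"
  using metric unfolding riemannian_metric_def by blast

lemma g_definite: "u \<in> T p \<Longrightarrow> g p u u = 0 \<longleftrightarrow> u = 0"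
  using g_pos[of u p] g_zero[of 0 p] by force

lemma g_smooth: "X \<in> XX \<Longrightarrow> Y \<in> XX \<Longrightarrow> (\<lambda>p. g p (X p) (Y p)) \<in> smooth_funs \<A>"
  using metric unfolding riemannian_metric_def by blast

text \<open>
  The difference of the two vectors is orthogonal to itself. This is what makes the definite
  descriptions in \<open>sharp\<close> and \<open>orth_proj\<close> meaningful.
\<close>

lemma representative_unique:
  assumes "subspace D" "D \<subseteq> T p" "u \<in> D" "v \<in> D" "\<And>w. w \<in> D \<Longrightarrow> g p u w = g p v w"
  shows "u = v"
proof -
  have uv: "u - v \<in> D" using assms subspace_diff by blast
  then have "g p (u - v) (u - v) = 0" using assms(5)[OF uv] assms by (subst g_diff) auto
  then show ?thesis using g_definite assms(2) uv by (metis eq_iff_diff_eq_0 subsetD)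
qed

definition orthogonal_nonzero :: "'m \<Rightarrow> nat \<Rightarrow> (nat \<Rightarrow> 'm tvec) \<Rightarrow> bool" where
  "orthogonal_nonzero p n F \<longleftrightarrow> (\<forall>i<n. F i \<in> T p \<and> F i \<noteq> 0) \<and>
     (\<forall>i<n. \<forall>j<n. i \<noteq> j \<longrightarrow> g p (F i) (F j) = 0)"

lemma orthogonal_coefficient:
  assumes "orthogonal_nonzero p n F" "j < n"
  shows "g p (\<Sum>i<n. c i *\<^sub>R F i) (F j) = c j * g p (F j) (F j)"
proof -
  have "g p (\<Sum>i<n. c i *\<^sub>R F i) (F j) = (\<Sum>i<n. c i * g p (F i) (F j))"
    using assms by (intro g_sum) (auto simp: orthogonal_nonzero_def)
  also have "\<dots> = (\<Sum>i<n. if i = j then c j * g p (F j) (F j) else 0)"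
    using assms by (intro sum.cong) (auto simp: orthogonal_nonzero_def)
  finally show ?thesis using assms(2) by simp
qed

lemma orthogonal_nonzero_inj:
  assumes "orthogonal_nonzero p n F"
  shows "inj_on F {..<n}"
proof (rule inj_onI, rule ccontr)
  fix i j assume "i \<in> {..<n}" "j \<in> {..<n}" "F i = F j" "i \<noteq> j"
  then show False using assms g_definite[of "F i" p] unfolding orthogonal_nonzero_def by force
qed

lemma orthogonal_nonzero_independent:
  assumes "orthogonal_nonzero p n F"
  shows "independent (F ` {..<n})"
proof
  assume "dependent (F ` {..<n})"
  then obtain c j where j: "j < n" "c (F j) \<noteq> 0" and 0: "(\<Sum>v\<in>F ` {..<n}. c v *\<^sub>R v) = 0"
    by (auto simp: dependent_finite)
  have "(\<Sum>i<n. c (F i) *\<^sub>R F i) = 0"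
    using 0 by (simp add: sum.reindex[OF orthogonal_nonzero_inj[OF assms]])
  then have "c (F j) * g p (F j) (F j) = 0"
    using orthogonal_coefficient[OF assms j(1), of "\<lambda>i. c (F i)"] g_zero assms j
    by (simp add: orthogonal_nonzero_def)
  then show False using j assms g_definite by (simp add: orthogonal_nonzero_def)
qed

text \<open>
  Values outside \<open>T p\<close> are left open, so that both covectors, which are zero there, and
  \<open>g p u\<close>, which is arbitrary there, are covered.
\<close>

definition linear_at :: "'m \<Rightarrow> ('m tvec \<Rightarrow> real) \<Rightarrow> bool" where
  "linear_at p \<alpha> \<longleftrightarrow> (\<forall>u\<in>T p. \<forall>v\<in>T p. \<alpha> (u + v) = \<alpha> u + \<alpha> v) \<and>
     (\<forall>c. \<forall>v\<in>T p. \<alpha> (c *\<^sub>R v) = c * \<alpha> v)"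

lemma linear_at_cotangent: "\<alpha> \<in> cotangent_space \<A> p \<Longrightarrow> linear_at p \<alpha>"
  by (simp add: cotangent_space_def linear_at_def)

lemma linear_at_metric: "u \<in> T p \<Longrightarrow> linear_at p (g p u)"
  by (simp add: linear_at_def g_add_right g_scale_right)

lemma linear_at_eq_on_span:
  assumes "linear_at p \<alpha>" "linear_at p \<beta>" "B \<subseteq> T p" "\<And>b. b \<in> B \<Longrightarrow> \<alpha> b = \<beta> b" "w \<in> span B"
  shows "\<alpha> w = \<beta> w"
proof -
  have 0: "\<gamma> 0 = 0" if "linear_at p \<gamma>" for \<gamma>
    using that T_zero[of p] unfolding linear_at_def by (metis mult_zero_left scale_zero_left)
  have "w \<in> T p \<and> \<alpha> w = \<beta> w"
    using assms(5)
  proof (induction rule: span_induct_alt)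
    case base
    then show ?case using 0[OF assms(1)] 0[OF assms(2)] T_zero by metis
  next
    case (step c x y)
    then show ?case
      using assms(1-4) T_add T_scale unfolding linear_at_def by (metis subsetD)
  qed
  then show ?thesis by simp
qed

lemma sharp_eqI:
  assumes "subspace (D p)" "D p \<subseteq> T p" "u \<in> D p" "\<And>w. w \<in> D p \<Longrightarrow> g p u w = \<alpha> w"
  shows "sharp g D p \<alpha> = u"
  unfolding sharp_def
  by (rule the_equality) (use assms representative_unique[OF assms(1,2)] in auto)

lemma sharp_orthogonal:
  assumes "orthogonal_nonzero p n F" "span (F ` {..<n}) = D p" "linear_at p \<alpha>"
  shows "sharp g D p \<alpha> = (\<Sum>i<n. (\<alpha> (F i) / g p (F i) (F i)) *\<^sub>R F i)" (is "_ = ?u")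
    and "sharp g D p \<alpha> \<in> D p" and "w \<in> D p \<Longrightarrow> g p (sharp g D p \<alpha>) w = \<alpha> w"
proof -
  have F: "F ` {..<n} \<subseteq> T p" using assms(1) by (auto simp: orthogonal_nonzero_def)
  then have DT: "D p \<subseteq> T p" using assms(2) span_minimal subspace_tangent by metis
  have D: "subspace (D p)" using assms(2) subspace_span by metis
  have u: "?u \<in> D p" unfolding assms(2)[symmetric] by (intro span_sum span_scale span_base) auto
  have "g p ?u b = \<alpha> b" if "b \<in> F ` {..<n}" for b
  proof -
    from that obtain j where j: "j < n" "b = F j" by auto
    then have "g p (F j) (F j) \<noteq> 0"
      using assms(1) g_definite by (simp add: orthogonal_nonzero_def)
    then show ?thesis using orthogonal_coefficient[OF assms(1) j(1)] j(2) by simp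
  qed
  then have gu: "g p ?u w = \<alpha> w" if "w \<in> D p" for w
    using linear_at_eq_on_span[OF linear_at_metric assms(3) F] u DT that assms(2) by blast
  show eq: "sharp g D p \<alpha> = ?u" by (rule sharp_eqI[where u = ?u]) (use D DT u gu in auto)
  show "sharp g D p \<alpha> \<in> D p" "w \<in> D p \<Longrightarrow> g p (sharp g D p \<alpha>) w = \<alpha> w"
    using eq u gu by auto
qed

end

section \<open>Orthogonal frames by global vector fields\<close>

context riemannian_manifold
begin

text \<open>
  The Gram-Schmidt process with all denominators cleared, so that the new fields are again smooth on the
  whole manifold, and orthogonal even where the given ones are dependent.
\<close>

lemma gram_schmidt_fields:
  assumes "\<And>i. i < (n::nat) \<Longrightarrow> E i \<in> XX"
  shows "\<exists>F. (\<forall>i<n. F i \<in> XX) \<and> (\<forall>q. \<forall>i<n. \<forall>j<n. i \<noteq> j \<longrightarrow> g q (F i q) (F j q) = 0) \<and>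
    (\<forall>q. inj_on (\<lambda>i. E i q) {..<n} \<and> independent ((\<lambda>i. E i q) ` {..<n}) \<longrightarrow>
      (\<forall>i<n. F i q \<noteq> 0) \<and> span ((\<lambda>i. F i q) ` {..<n}) = span ((\<lambda>i. E i q) ` {..<n}))"
  using assms
proof (induction n)
  case 0
  then show ?case by simp
next
  case (Suc n)
  then obtain F where F: "\<And>i. i < n \<Longrightarrow> F i \<in> XX"
    and orth: "\<And>q i j. i < n \<Longrightarrow> j < n \<Longrightarrow> i \<noteq> j \<Longrightarrow> g q (F i q) (F j q) = 0"
    and sp: "\<And>q. inj_on (\<lambda>i. E i q) {..<n} \<Longrightarrow> independent ((\<lambda>i. E i q) ` {..<n}) \<Longrightarrow>
      (\<forall>i<n. F i q \<noteq> 0) \<and> span ((\<lambda>i. F i q) ` {..<n}) = span ((\<lambda>i. E i q) ` {..<n})"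
    by (metis less_SucI)
  have En: "E n \<in> XX" using Suc.prems by simp
  define N where "N i q = g q (F i q) (F i q)" for i q
  \<comment> \<open>\<open>L\<close> is the usual Gram-Schmidt vector multiplied by the product \<open>P\<close> of all squared lengths.\<close>
  define P where "P q = (\<Prod>l<n. N l q)" for q
  define c where "c i q = (\<Prod>l\<in>{..<n} - {i}. N l q) * g q (E n q) (F i q)" for i q
  define W where "W q = (\<Sum>i<n. c i q *\<^sub>R F i q)" for q
  define L where "L = (\<lambda>q. P q *\<^sub>R E n q) - W"
  have N: "N i \<in> smooth_funs \<A>" if "i < n" for i
    unfolding N_def using F[OF that] g_smooth by blast
  have P: "P \<in> smooth_funs \<A>" unfolding P_def using N by (intro smooth_prod) auto
  have c: "c i \<in> smooth_funs \<A>" if "i < n" for i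
    unfolding c_def using N F[OF that] by (intro smooth_mult smooth_prod g_smooth En) auto
  have W: "W \<in> XX" unfolding W_def using F c by (intro field_sum field_scale) auto
  have L: "L \<in> XX" unfolding L_def using W P En by (intro field_diff field_scale)
  have Lorth: "g q (L q) (F j q) = 0" if "j < n" for q j
  proof -
    have FT: "F i q \<in> T q" if "i < n" for i using F[OF that] field_tangent by blast
    have "g q (W q) (F j q) = (\<Sum>i<n. c i q * g q (F i q) (F j q))"
      unfolding W_def by (rule g_sum) (use FT that in auto)
    also have "\<dots> = (\<Sum>i<n. if i = j then c j q * N j q else 0)"
      using orth that by (intro sum.cong) (auto simp: N_def)
    also have "\<dots> = c j q * N j q" using that by simp
    also have "\<dots> = P q * g q (E n q) (F j q)"
      using that by (simp add: c_def P_def prod.remove[of "{..<n}" j] mult_ac)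
    finally show ?thesis
      unfolding L_def using FT[OF that] field_tangent[OF W] field_tangent[OF En]
      by (simp add: g_diff g_scale T_scale)
  qed
  define F' where "F' = F(n := L)"
  have F': "F' i \<in> XX" if "i < Suc n" for i using that F L by (auto simp: F'_def less_Suc_eq)
  have orth': "g q (F' i q) (F' j q) = 0" if "i < Suc n" "j < Suc n" "i \<noteq> j" for q i j
  proof -
    have "g q (F j q) (L q) = 0" if "j < n" for j
      using Lorth[OF that, of q] g_sym field_tangent F[OF that] L by metis
    then show ?thesis using that orth Lorth by (auto simp: F'_def less_Suc_eq)
  qed
  have "(\<forall>i<Suc n. F' i q \<noteq> 0) \<and> span ((\<lambda>i. F' i q) ` {..<Suc n}) = span ((\<lambda>i. E i q) ` {..<Suc n})"
    if inj: "inj_on (\<lambda>i. E i q) {..<Suc n}" and ind: "independent ((\<lambda>i. E i q) ` {..<Suc n})" for q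
  proof -
    have insE: "(\<lambda>i. E i q) ` {..<Suc n} = insert (E n q) ((\<lambda>i. E i q) ` {..<n})"
      by (auto simp: lessThan_Suc)
    have insF: "(\<lambda>i. F' i q) ` {..<Suc n} = insert (L q) ((\<lambda>i. F i q) ` {..<n})"
      by (auto simp: lessThan_Suc F'_def)
    have inj': "inj_on (\<lambda>i. E i q) {..<n}" and "E n q \<notin> (\<lambda>i. E i q) ` {..<n}"
      using inj by (auto simp: lessThan_Suc)
    then have ind': "independent ((\<lambda>i. E i q) ` {..<n})"
      and notin: "E n q \<notin> span ((\<lambda>i. E i q) ` {..<n})"
      using ind unfolding insE independent_insert by auto
    have nz: "\<And>i. i < n \<Longrightarrow> F i q \<noteq> 0"
      and spF: "span ((\<lambda>i. F i q) ` {..<n}) = span ((\<lambda>i. E i q) ` {..<n})"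
      using sp[OF inj' ind'] by auto
    have P0: "P q \<noteq> 0"
      using nz F field_tangent g_definite by (auto simp: P_def N_def)
    have Wsp: "W q \<in> span ((\<lambda>i. F i q) ` {..<n})"
      unfolding W_def by (intro span_sum span_scale span_base) auto
    have Eq: "E n q = (1 / P q) *\<^sub>R (L q + W q)" using P0 by (simp add: L_def)
    have "L q \<noteq> 0"
    proof
      assume "L q = 0"
      then have "E n q \<in> span ((\<lambda>i. E i q) ` {..<n})"
        using Eq span_scale[OF Wsp, of "1 / P q"] spF by simp
      then show False using notin by simp
    qed
    moreover have "span (insert (L q) ((\<lambda>i. F i q) ` {..<n})) =
        span (insert (E n q) ((\<lambda>i. E i q) ` {..<n}))" (is "span ?A = span ?B")
      unfolding span_eq
    proof
      have B: "span ((\<lambda>i. E i q) ` {..<n}) \<subseteq> span ?B" and A: "span ((\<lambda>i. F i q) ` {..<n}) \<subseteq> span ?A"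
        by (auto intro!: span_mono)
      have "L q \<in> span ?B"
        unfolding L_def using Wsp B spF
        by (auto intro!: span_diff span_scale span_base[of "E n q"])
      then show "?A \<subseteq> span ?B"
        using B spF span_superset[of "(\<lambda>i. F i q) ` {..<n}"] by blast
      have "E n q \<in> span ?A"
        unfolding Eq using Wsp A by (intro span_scale span_add) (auto intro: span_base)
      then show "?B \<subseteq> span ?A"
        using A spF span_superset[of "(\<lambda>i. E i q) ` {..<n}"] by blast
    qed
    ultimately show ?thesis
      unfolding insE insF using nz by (auto simp: F'_def less_Suc_eq)
  qed
  with F' orth' show ?case by (intro exI[of _ F']) blast
qed

definition tangent_subbundle :: "('m \<Rightarrow> 'm tvec set) \<Rightarrow> bool" where
  "tangent_subbundle D \<longleftrightarrow> smooth_subbundle \<A> D \<and> (\<forall>p. D p \<subseteq> T p)"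

text \<open>
  The frame spans only over \<open>U\<close>, but consists of fields on the whole manifold that are orthogonal
  everywhere; the global expansion of vector fields below relies on the latter.
\<close>

definition local_frame ::
  "('m \<Rightarrow> 'm tvec set) \<Rightarrow> 'm set \<Rightarrow> nat \<Rightarrow> (nat \<Rightarrow> 'm vfield) \<Rightarrow> bool" where
  "local_frame D U n F \<longleftrightarrow> open U \<and> (\<forall>i<n. F i \<in> XX) \<and>
     (\<forall>q. \<forall>i<n. \<forall>j<n. i \<noteq> j \<longrightarrow> g q (F i q) (F j q) = 0) \<and>
     (\<forall>q\<in>U. orthogonal_nonzero q n (\<lambda>i. F i q) \<and> span ((\<lambda>i. F i q) ` {..<n}) = D q)"

lemma local_frameD:
  assumes "local_frame D U n F"
  shows "open U" "i < n \<Longrightarrow> F i \<in> XX"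
    "i < n \<Longrightarrow> j < n \<Longrightarrow> i \<noteq> j \<Longrightarrow> g q (F i q) (F j q) = 0"
    "q \<in> U \<Longrightarrow> orthogonal_nonzero q n (\<lambda>i. F i q)"
    "q \<in> U \<Longrightarrow> span ((\<lambda>i. F i q) ` {..<n}) = D q"
  using assms by (simp_all add: local_frame_def)

lemma orthogonal_frame:
  assumes "tangent_subbundle D"
  obtains U n F where "p \<in> U" "local_frame D U n F"
proof -
  obtain U n E where U: "open U" "p \<in> U" and E: "\<And>i. i < (n::nat) \<Longrightarrow> E i \<in> XX"
    and D: "\<And>q. q \<in> U \<Longrightarrow> inj_on (\<lambda>i. E i q) {..<n}"
      "\<And>q. q \<in> U \<Longrightarrow> independent ((\<lambda>i. E i q) ` {..<n})"
      "\<And>q. q \<in> U \<Longrightarrow> span ((\<lambda>i. E i q) ` {..<n}) = D q"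
    using assms unfolding tangent_subbundle_def smooth_subbundle_def by metis
  from gram_schmidt_fields[of n E, OF E] obtain F where F: "\<forall>i<n. F i \<in> XX"
    "\<forall>q. \<forall>i<n. \<forall>j<n. i \<noteq> j \<longrightarrow> g q (F i q) (F j q) = 0"
    "\<forall>q. inj_on (\<lambda>i. E i q) {..<n} \<and> independent ((\<lambda>i. E i q) ` {..<n}) \<longrightarrow>
      (\<forall>i<n. F i q \<noteq> 0) \<and> span ((\<lambda>i. F i q) ` {..<n}) = span ((\<lambda>i. E i q) ` {..<n})"
    by blast
  have "local_frame D U n F"
    unfolding local_frame_def orthogonal_nonzero_def
    using U F D field_tangent by simp
  then show thesis using that U(2) by blast
qed

lemma subbundle_subspace:
  assumes "tangent_subbundle D"
  shows "subspace (D p)"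
proof -
  obtain U n F where "p \<in> U" "local_frame D U n F" using orthogonal_frame[OF assms] .
  then show ?thesis using local_frameD(5) subspace_span by metis
qed

lemma subbundle_tangent: "tangent_subbundle D \<Longrightarrow> v \<in> D p \<Longrightarrow> v \<in> T p"
  by (auto simp: tangent_subbundle_def)

lemma sharp_local_frame:
  assumes "local_frame D U n F" "q \<in> U" "linear_at q \<alpha>"
  shows "sharp g D q \<alpha> = (\<Sum>i<n. (\<alpha> (F i q) / g q (F i q) (F i q)) *\<^sub>R F i q)"
    and "sharp g D q \<alpha> \<in> D q" and "w \<in> D q \<Longrightarrow> g q (sharp g D q \<alpha>) w = \<alpha> w"
  using sharp_orthogonal[where D = D and F = "\<lambda>i. F i q" and p = q and n = n and \<alpha> = \<alpha>]
    local_frameD(4,5)[OF assms(1,2)] assms(3) by blast+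

lemma sharp_props:
  assumes "tangent_subbundle D" "linear_at p \<alpha>"
  shows "sharp g D p \<alpha> \<in> D p" and "w \<in> D p \<Longrightarrow> g p (sharp g D p \<alpha>) w = \<alpha> w"
proof -
  obtain U n F where p: "p \<in> U" and F: "local_frame D U n F" using orthogonal_frame[OF assms(1)] .
  show "sharp g D p \<alpha> \<in> D p" "w \<in> D p \<Longrightarrow> g p (sharp g D p \<alpha>) w = \<alpha> w"
    using sharp_local_frame(2,3)[OF F p assms(2)] .
qed

lemma sharp_unique:
  assumes "tangent_subbundle D" "u \<in> D p" "\<And>w. w \<in> D p \<Longrightarrow> g p u w = \<alpha> w"
  shows "sharp g D p \<alpha> = u"
  by (rule sharp_eqI)
    (use assms subbundle_subspace[OF assms(1)] subbundle_tangent[OF assms(1)] in auto)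

text \<open>
  Near each point \<open>sharp\<close> is given by the expansion in an orthogonal frame, whose coefficients are
  quotients of smooth functions. Orthogonal projections and gradients of functions are special cases.
\<close>

lemma sharp_field:
  assumes D: "tangent_subbundle D" and lin: "\<And>p. linear_at p (\<alpha> p)"
    and smooth: "\<And>X. X \<in> XX \<Longrightarrow> (\<lambda>p. \<alpha> p (X p)) \<in> smooth_funs \<A>"
  shows "(\<lambda>p. sharp g D p (\<alpha> p)) \<in> XX"
  unfolding vector_fields_def
proof (clarsimp, intro conjI allI ballI)
  show "sharp g D p (\<alpha> p) \<in> T p" for p
    using sharp_props(1)[OF D lin] subbundle_tangent[OF D] by blast
  fix f assume f: "f \<in> smooth_funs \<A>"
  show "(\<lambda>p. sharp g D p (\<alpha> p) f) \<in> smooth_funs \<A>"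
  proof (rule smooth_funs_local)
    fix p
    obtain U n F where p: "p \<in> U" and lf: "local_frame D U n F" using orthogonal_frame[OF D] .
    note U = local_frameD(1)[OF lf] p and F = local_frameD(2)[OF lf]
      and o = local_frameD(4)[OF lf] and sp = local_frameD(5)[OF lf]
    have "(\<lambda>q. \<Sum>i<n. \<alpha> q (F i q) * inverse (g q (F i q) (F i q)) * F i q f) \<in> smooth_funs_on \<A> U"
    proof (intro smooth_funs_on_sum smooth_funs_on_mult smooth_funs_on_inverse U(1))
      fix i q assume "i < n" "q \<in> U"
      then show "g q (F i q) (F i q) \<noteq> 0"
        using o[of q] g_definite by (auto simp: orthogonal_nonzero_def)
    qed (use F f smooth g_smooth field_smooth smooth_funs_restrict in auto)
    then have "(\<lambda>q. sharp g D q (\<alpha> q) f) \<in> smooth_funs_on \<A> U"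
      by (rule smooth_funs_on_cong[OF U(1), rotated])
        (simp add: sharp_local_frame(1)[OF lf _ lin] sum_tvec_apply divide_inverse)
    then show "\<exists>U. open U \<and> p \<in> U \<and> (\<lambda>q. sharp g D q (\<alpha> q) f) \<in> smooth_funs_on \<A> U"
      using U by blast
  qed
qed

section \<open>Orthogonal projections of vector fields\<close>

lemma orth_proj_eq_sharp:
  assumes "tangent_subbundle D" "v \<in> T p"
  shows "orth_proj g D p v = sharp g D p (g p v)"
proof -
  have "u \<in> D p \<and> (\<forall>w\<in>D p. g p (v - u) w = 0) \<longleftrightarrow> u \<in> D p \<and> (\<forall>w\<in>D p. g p u w = g p v w)" for u
    using assms subbundle_tangent by (auto simp: g_diff)
  then show ?thesis unfolding orth_proj_def sharp_def by simp
qed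

lemma pr_in: "tangent_subbundle D \<Longrightarrow> X \<in> XX \<Longrightarrow> pr g D X p \<in> D p"
  unfolding pr_def by (simp add: orth_proj_eq_sharp field_tangent sharp_props linear_at_metric)

lemma g_pr: "tangent_subbundle D \<Longrightarrow> X \<in> XX \<Longrightarrow> w \<in> D p \<Longrightarrow> g p (pr g D X p) w = g p (X p) w"
  unfolding pr_def by (simp add: orth_proj_eq_sharp field_tangent sharp_props linear_at_metric)

lemma g_pr_right:
  "tangent_subbundle D \<Longrightarrow> X \<in> XX \<Longrightarrow> w \<in> D p \<Longrightarrow> g p w (pr g D X p) = g p w (X p)"
  by (metis g_pr g_sym field_tangent pr_in subbundle_tangent)

lemma pr_unique:
  "tangent_subbundle D \<Longrightarrow> X \<in> XX \<Longrightarrow> u \<in> D p \<Longrightarrow> (\<And>w. w \<in> D p \<Longrightarrow> g p u w = g p (X p) w) \<Longrightarrow>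
    pr g D X p = u"
  unfolding pr_def by (simp add: orth_proj_eq_sharp field_tangent sharp_unique)

lemma pr_field: "tangent_subbundle D \<Longrightarrow> X \<in> XX \<Longrightarrow> pr g D X \<in> XX"
  unfolding pr_def
  by (simp add: orth_proj_eq_sharp field_tangent)
    (intro sharp_field linear_at_metric field_tangent g_smooth)

lemma pr_add:
  assumes "tangent_subbundle D" "X \<in> XX" "Y \<in> XX"
  shows "pr g D (X + Y) = pr g D X + pr g D Y"
proof
  fix p show "pr g D (X + Y) p = (pr g D X + pr g D Y) p"
    using assms subbundle_subspace[OF assms(1)] pr_in subbundle_tangent[OF assms(1)] g_pr field_tangent
    by (intro pr_unique) (auto intro: subspace_add field_add simp: g_add)
qed

lemma pr_scale:
  assumes "tangent_subbundle D" "X \<in> XX" "f \<in> smooth_funs \<A>"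
  shows "pr g D (\<lambda>p. f p *\<^sub>R X p) = (\<lambda>p. f p *\<^sub>R pr g D X p)"
proof
  fix p show "pr g D (\<lambda>p. f p *\<^sub>R X p) p = f p *\<^sub>R pr g D X p"
    using assms subbundle_subspace[OF assms(1)] pr_in subbundle_tangent[OF assms(1)] g_pr field_tangent
    by (intro pr_unique) (auto intro: subspace_scale field_scale simp: g_scale)
qed

lemma pr_id: "tangent_subbundle D \<Longrightarrow> X \<in> XX \<Longrightarrow> (\<And>p. X p \<in> D p) \<Longrightarrow> pr g D X = X"
  by (rule ext) (intro pr_unique, auto)

section \<open>Tensoriality\<close>

text \<open>
  The usual proof that a \<open>C\<^sup>\<infinity>\<close>-linear map is pointwise multiplies a local expansion by a bump
  function. Here the multiplier \<open>\<mu>\<close> is the product of the squared lengths of an orthogonal frame at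
  \<open>p\<close>, cut off to the set where the tangent space has the same dimension as at \<open>p\<close>: where some frame
  field vanishes both sides are zero, and elsewhere in this set the frame spans for reasons of
  dimension. The cut-off is smooth because the dimension is locally constant.
\<close>

lemma global_expansion:
  assumes "tangent_subbundle T"
  obtains \<mu> n F where "\<mu> \<in> smooth_funs \<A>" "\<mu> p \<noteq> 0" "\<forall>i<n::nat. F i \<in> XX"
    "\<forall>Z\<in>XX. \<exists>c. (\<forall>i<n. c i \<in> smooth_funs \<A> \<and> (Z p = 0 \<longrightarrow> c i p = 0)) \<and>
       (\<lambda>q. \<mu> q *\<^sub>R Z q) = (\<lambda>q. \<Sum>i<n. c i q *\<^sub>R F i q)"
proof -
  obtain U n F where p: "p \<in> U" and lf: "local_frame T U n F" using orthogonal_frame[OF assms] .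
  note U = local_frameD(1)[OF lf] p and F = local_frameD(2)[OF lf] and orth = local_frameD(3)[OF lf]
    and o = local_frameD(4)[OF lf] and sp = local_frameD(5)[OF lf]
  define has_dim where "has_dim q m \<longleftrightarrow> (\<exists>B. finite B \<and> independent B \<and> card B = m \<and> span B = T q)"
    for q and m :: nat
  have frame_dim: "has_dim q m" if "orthogonal_nonzero q m G" "span (G ` {..<m}) = T q" for q m G
    unfolding has_dim_def
    by (rule exI[of _ "G ` {..<m}"])
      (use that orthogonal_nonzero_inj orthogonal_nonzero_independent card_image in force)
  have dim_unique: "m = m'" if m: "has_dim q m" "has_dim q m'" for q m m'
  proof -
    obtain B B' where "finite B" "independent B" "card B = m" "span B = T q"
      "finite B'" "independent B'" "card B' = m'" "span B' = T q"
      using m unfolding has_dim_def by metis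
    then show ?thesis
      using independent_span_bound[of B B'] independent_span_bound[of B' B] span_superset
      by (metis order_antisym)
  qed
  define \<theta> :: "'m \<Rightarrow> real" where "\<theta> q = (if has_dim q n then 1 else 0)" for q
  have \<theta>: "\<theta> \<in> smooth_funs \<A>"
  proof (rule smooth_funs_local)
    fix p'
    obtain U' m G where p': "p' \<in> U'" and lf': "local_frame T U' m G"
      using orthogonal_frame[OF assms] .
    note U' = local_frameD(1)[OF lf'] p'
    have "has_dim q m" if "q \<in> U'" for q using frame_dim local_frameD(4,5)[OF lf' that] .
    then have "\<theta> q = (if m = n then 1 else 0)" if "q \<in> U'" for q
      unfolding \<theta>_def using dim_unique that by metis
    then have "\<theta> \<in> smooth_funs_on \<A> U'"
      using smooth_funs_on_cong[OF U'(1) _ smooth_funs_on_const[of "if m = n then 1 else 0"]] by metis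
    then show "\<exists>U. open U \<and> p' \<in> U \<and> \<theta> \<in> smooth_funs_on \<A> U" using U' by blast
  qed
  define N where "N i q = g q (F i q) (F i q)" for i q
  have N: "N i \<in> smooth_funs \<A>" if "i < n" for i
    unfolding N_def using F[OF that] g_smooth by blast
  define \<mu> where "\<mu> q = \<theta> q * (\<Prod>l<n. N l q)" for q
  have \<mu>: "\<mu> \<in> smooth_funs \<A>"
    unfolding \<mu>_def using N by (intro smooth_mult \<theta> smooth_prod) auto
  have "has_dim p n" using frame_dim o sp U by blast
  moreover have "N l p \<noteq> 0" if "l < n" for l
    using o[OF U(2)] that g_definite by (simp add: N_def orthogonal_nonzero_def)
  ultimately have \<mu>p: "\<mu> p \<noteq> 0" by (simp add: \<mu>_def \<theta>_def)
  have "\<exists>c. (\<forall>i<n. c i \<in> smooth_funs \<A> \<and> (Z p = 0 \<longrightarrow> c i p = 0)) \<and>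
       (\<lambda>q. \<mu> q *\<^sub>R Z q) = (\<lambda>q. \<Sum>i<n. c i q *\<^sub>R F i q)" if Z: "Z \<in> XX" for Z
  proof -
    define c where "c i q = \<theta> q * (\<Prod>l\<in>{..<n} - {i}. N l q) * g q (Z q) (F i q)" for i q
    have "c i \<in> smooth_funs \<A>" if "i < n" for i
      unfolding c_def using N F[OF that] by (intro smooth_mult \<theta> smooth_prod g_smooth Z) auto
    moreover have "c i p = 0" if "i < n" "Z p = 0" for i
      using that F field_tangent g_zero by (simp add: c_def)
    moreover have "\<mu> q *\<^sub>R Z q = (\<Sum>i<n. c i q *\<^sub>R F i q)" for q
    proof -
      have FT: "F i q \<in> T q" if "i < n" for i using F[OF that] field_tangent by blast
      have cN: "c i q * N i q = \<mu> q * g q (Z q) (F i q)" if "i < n" for i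
        using that by (simp add: c_def \<mu>_def prod.remove[of "{..<n}" i] mult_ac)
      consider "\<not> has_dim q n" | j where "j < n" "F j q = 0" | "has_dim q n" "\<forall>i<n. F i q \<noteq> 0"
        by blast
      then show ?thesis
      proof cases
        case 1
        then show ?thesis by (simp add: c_def \<mu>_def \<theta>_def)
      next
        case 2
        then have Nj: "N j q = 0" using g_zero(1)[OF T_zero] by (simp add: N_def)
        have "c i q *\<^sub>R F i q = 0" if "i < n" for i
        proof (cases "i = j")
          case True
          then show ?thesis using 2 by simp
        next
          case False
          then have "(\<Prod>l\<in>{..<n} - {i}. N l q) = 0" using Nj 2 by auto
          then show ?thesis by (simp add: c_def)
        qed
        moreover have "\<mu> q = 0" using Nj 2 by (auto simp: \<mu>_def)
        ultimately show ?thesis by (simp only: scale_zero_left) (simp add: sum.neutral)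
      next
        case 3
        then have oq: "orthogonal_nonzero q n (\<lambda>i. F i q)"
          using FT orth by (simp add: orthogonal_nonzero_def)
        let ?S = "(\<lambda>i. F i q) ` {..<n}"
        obtain B where B: "finite B" "independent B" "card B = n" "span B = T q"
          using 3 has_dim_def by blast
        have sT: "?S \<subseteq> T q" using FT by auto
        have iS: "independent ?S" by (rule orthogonal_nonzero_independent[OF oq])
        have cS: "card ?S = n" using orthogonal_nonzero_inj[OF oq] by (simp add: card_image)
        have "T q \<subseteq> span ?S"
        proof
          fix v assume v: "v \<in> T q"
          show "v \<in> span ?S"
          proof (rule ccontr)
            assume nv: "v \<notin> span ?S"
            then have "independent (insert v ?S)" using iS by (simp add: independent_insert)
            then have "card (insert v ?S) \<le> n"
              using independent_span_bound[OF B(1), of "insert v ?S"] B sT v by auto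
            moreover have "v \<notin> ?S" using nv span_base[of v ?S] by metis
            then have "card (insert v ?S) = Suc (card ?S)" by (intro card_insert_disjoint) simp_all
            ultimately show False unfolding cS by linarith
          qed
        qed
        then have spq: "span ?S = T q" using span_minimal[OF sT subspace_tangent] by (rule subset_antisym[rotated])
        have Zq: "Z q \<in> T q" by (rule field_tangent[OF Z])
        have "Z q = sharp g T q (g q (Z q))"
          using sharp_unique[OF assms Zq] by simp
        also have "\<dots> = (\<Sum>i<n. (g q (Z q) (F i q) / N i q) *\<^sub>R F i q)"
          unfolding N_def by (rule sharp_orthogonal(1)[where D = T, OF oq spq linear_at_metric[OF Zq]])
        finally have Zeq: "Z q = (\<Sum>i<n. (g q (Z q) (F i q) / N i q) *\<^sub>R F i q)" .
        have "\<mu> q * (g q (Z q) (F i q) / N i q) = c i q" if "i < n" for i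
        proof -
          have "N i q \<noteq> 0" using 3 that g_definite FT by (simp add: N_def)
          then show ?thesis using cN[OF that] by (simp add: field_simps)
        qed
        then have "\<mu> q *\<^sub>R (\<Sum>i<n. (g q (Z q) (F i q) / N i q) *\<^sub>R F i q) = (\<Sum>i<n. c i q *\<^sub>R F i q)"
          by (simp add: scaleR_sum_right)
        then show ?thesis using Zeq by simp
      qed
    qed
    ultimately show ?thesis by blast
  qed
  then show thesis using that[OF \<mu> \<mu>p] F by blast
qed

definition tensorial_at :: "'m \<Rightarrow> ('m vfield \<Rightarrow> real) \<Rightarrow> bool" where
  "tensorial_at p \<Phi> \<longleftrightarrow> (\<forall>X\<in>XX. \<forall>Y\<in>XX. \<Phi> (X + Y) = \<Phi> X + \<Phi> Y) \<and>
     (\<forall>f\<in>smooth_funs \<A>. \<forall>X\<in>XX. \<Phi> (\<lambda>q. f q *\<^sub>R X q) = f p * \<Phi> X)"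

text \<open>Apply \<open>\<Phi>\<close> to the expansion of \<open>\<mu> Z\<close>: all coefficients vanish at \<open>p\<close>, but \<open>\<mu>\<close> does not.\<close>

lemma tensorial_vanishes:
  assumes T: "tangent_subbundle T" and \<Phi>: "tensorial_at p \<Phi>" and Z: "Z \<in> XX" "Z p = 0"
  shows "\<Phi> Z = 0"
proof -
  obtain \<mu> n F where \<mu>: "\<mu> \<in> smooth_funs \<A>" "\<mu> p \<noteq> 0" and F: "\<forall>i<n::nat. F i \<in> XX"
    and ex: "\<forall>Z\<in>XX. \<exists>c. (\<forall>i<n. c i \<in> smooth_funs \<A> \<and> (Z p = 0 \<longrightarrow> c i p = 0)) \<and>
       (\<lambda>q. \<mu> q *\<^sub>R Z q) = (\<lambda>q. \<Sum>i<n. c i q *\<^sub>R F i q)"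
    using global_expansion[OF T, of p] .
  obtain c where c: "\<And>i. i < n \<Longrightarrow> c i \<in> smooth_funs \<A>" "\<And>i. i < n \<Longrightarrow> c i p = 0"
    and eq: "(\<lambda>q. \<mu> q *\<^sub>R Z q) = (\<lambda>q. \<Sum>i<n. c i q *\<^sub>R F i q)"
    using bspec[OF ex Z(1)] Z(2) by blast
  have add: "\<Phi> (X + Y) = \<Phi> X + \<Phi> Y" if "X \<in> XX" "Y \<in> XX" for X Y
    using \<Phi> that unfolding tensorial_at_def by blast
  have scale: "\<Phi> (\<lambda>q. f q *\<^sub>R X q) = f p * \<Phi> X" if "f \<in> smooth_funs \<A>" "X \<in> XX" for f X
    using \<Phi> that unfolding tensorial_at_def by blast
  have "\<Phi> (\<lambda>q. \<Sum>i<m. c i q *\<^sub>R F i q) = 0" if "m \<le> n" for m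
    using that
  proof (induction m)
    case 0
    show ?case
      using scale[OF smooth_const[of 0] field_zero(1)]
      by (simp only: lessThan_0 sum.empty scale_zero_left mult_zero_left)
  next
    case (Suc m)
    have "\<Phi> ((\<lambda>q. \<Sum>i<m. c i q *\<^sub>R F i q) + (\<lambda>q. c m q *\<^sub>R F m q)) = 0"
      using Suc c F by (subst add) (auto intro!: field_sum field_scale simp: scale)
    then show ?case by (simp add: plus_fun_def)
  qed
  then have "\<Phi> (\<lambda>q. \<mu> q *\<^sub>R Z q) = 0" using eq by simp
  then show ?thesis using scale[OF \<mu>(1) Z(1)] \<mu>(2) by simp
qed

lemma tensorial_cong:
  assumes "tangent_subbundle T" "tensorial_at p \<Phi>" "X \<in> XX" "Y \<in> XX" "X p = Y p"
  shows "\<Phi> X = \<Phi> Y"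
proof -
  have "\<Phi> (X - Y) = 0" using assms by (intro tensorial_vanishes[OF assms(1,2)] field_diff) auto
  moreover have "\<Phi> (X - Y + Y) = \<Phi> (X - Y) + \<Phi> Y"
    using assms field_diff unfolding tensorial_at_def by blast
  ultimately show ?thesis by simp
qed

lemma tangent_extends:
  assumes "tangent_subbundle T" "v \<in> T p"
  obtains X where "X \<in> XX" "X p = v"
proof -
  obtain U n F where p: "p \<in> U" and lf: "local_frame T U n F" using orthogonal_frame[OF assms(1)] .
  note U = local_frameD(1)[OF lf] p and F = local_frameD(2)[OF lf]
    and o = local_frameD(4)[OF lf] and sp = local_frameD(5)[OF lf]
  define c where "c i = g p v (F i p) / g p (F i p) (F i p)" for i
  have "v = (\<Sum>i<n. c i *\<^sub>R F i p)"
    unfolding c_def using sharp_unique[where u = v and \<alpha> = "g p v", OF assms]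
      sharp_local_frame(1)[OF lf p linear_at_metric[OF assms(2)]] by simp
  moreover have "(\<lambda>q. \<Sum>i<n. c i *\<^sub>R F i q) \<in> XX"
  proof (rule field_sum)
    fix i assume "i \<in> {..<n}"
    then show "(\<lambda>q. c i *\<^sub>R F i q) \<in> XX" using field_scale[OF smooth_const F] by simp
  qed
  ultimately show thesis using that[of "\<lambda>q. \<Sum>i<n. c i *\<^sub>R F i q"] by simp
qed

lemma covector_is_differential:
  assumes "tangent_subbundle T" "linear_at p \<alpha>"
  obtains f where "f \<in> smooth_funs \<A>" "\<And>v. v \<in> T p \<Longrightarrow> v f = \<alpha> v"
proof -
  obtain U n F where p: "p \<in> U" and lf: "local_frame T U n F" using orthogonal_frame[OF assms(1)] .
  note U = local_frameD(1)[OF lf] p and F = local_frameD(2)[OF lf]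
    and o = local_frameD(4)[OF lf] and sp = local_frameD(5)[OF lf]
  note o = o[OF U(2)] and sp = sp[OF U(2)]
  obtain f where f: "f \<in> smooth_funs \<A>" "\<And>i. i < n \<Longrightarrow> F i p f = \<alpha> (F i p)"
    using independent_functionals_attain[OF orthogonal_nonzero_inj[OF o]
      orthogonal_nonzero_independent[OF o], of p "\<lambda>i. \<alpha> (F i p)"] F field_tangent by blast
  have "v f = \<alpha> v" if "v \<in> T p" for v
  proof (rule linear_at_eq_on_span[of p "\<lambda>v. v f"])
    show "linear_at p (\<lambda>v. v f)" by (simp add: linear_at_def scaleR_fun_def)
    show "(\<lambda>i. F i p) ` {..<n} \<subseteq> T p" using F field_tangent by blast
    show "v \<in> span ((\<lambda>i. F i p) ` {..<n})" using that sp by simp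
    show "b f = \<alpha> b" if "b \<in> (\<lambda>i. F i p) ` {..<n}" for b using that f(2) by blast
  qed (rule assms(2))
  then show thesis using that f by blast
qed

end

section \<open>The splitting and the Lie derivative of the metric\<close>

locale split_manifold = riemannian_manifold \<A> g
  for \<A> :: "('m::topological_space, 'e::euclidean_space) atlas" and g :: "'m metric_field" +
  fixes H V :: "'m \<Rightarrow> 'm tvec set" and nabla :: "'m connection"
  assumes splitting: "orthogonal_splitting \<A> g H V"
    and levi_civita: "levi_civita \<A> g nabla"
begin

lemma splitting_props:
  "smooth_subbundle \<A> H" "smooth_subbundle \<A> V"
  "{u + w | u w. u \<in> H p \<and> w \<in> V p} = T p" "H p \<inter> V p = {0}"
  "u \<in> H p \<Longrightarrow> w \<in> V p \<Longrightarrow> g p u w = 0"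
  using splitting by (simp_all add: orthogonal_splitting_def)

lemmas HV_orthogonal = splitting_props(5)

lemma H_subbundle: "tangent_subbundle H" and V_subbundle: "tangent_subbundle V"
proof -
  have 0: "0 \<in> H p" "0 \<in> V p" for p using splitting_props(4)[of p] by auto
  have sum: "u + w \<in> T p" if "u \<in> H p" "w \<in> V p" for u w p
    unfolding splitting_props(3)[symmetric] using that by (intro CollectI exI conjI) (rule refl)
  have "H p \<subseteq> T p" "V p \<subseteq> T p" for p using sum[OF _ 0(2), of _ p] sum[OF 0(1), of _ p] by auto
  then show "tangent_subbundle H" "tangent_subbundle V"
    using splitting_props(1,2) unfolding tangent_subbundle_def by auto
qed

lemmas H_tangent = subbundle_tangent[OF H_subbundle]
lemmas V_tangent = subbundle_tangent[OF V_subbundle]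

lemma VH_orthogonal: "w \<in> V p \<Longrightarrow> u \<in> H p \<Longrightarrow> g p w u = 0"
  using HV_orthogonal g_sym H_tangent V_tangent by metis

text \<open>Orthogonal frames of \<open>H\<close> and \<open>V\<close> together form an orthogonal, hence independent, family.\<close>

lemma tangent_space_subbundle: "tangent_subbundle T"
  unfolding tangent_subbundle_def smooth_subbundle_def
proof (intro conjI allI subset_refl)
  fix p
  obtain U n F where U: "p \<in> U" "local_frame H U n F" using orthogonal_frame[OF H_subbundle] .
  obtain U' m G where U': "p \<in> U'" "local_frame V U' m G" using orthogonal_frame[OF V_subbundle] .
  note F = local_frameD[OF U(2)] and G = local_frameD[OF U'(2)]
  define E where "E i = (if i < n then F i else G (i - n))" for i
  have E: "E i \<in> XX" if "i < n + m" for i using that F(2) G(2) by (auto simp: E_def)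
  have img: "(\<lambda>i. E i q) ` {..<n + m} = (\<lambda>i. F i q) ` {..<n} \<union> (\<lambda>i. G i q) ` {..<m}" (is "?L = ?R") for q
  proof
    show "?L \<subseteq> ?R" by (auto simp: E_def)
    show "?R \<subseteq> ?L"
    proof
      fix v assume "v \<in> ?R"
      then consider i where "i < n" "v = F i q" | i where "i < m" "v = G i q" by auto
      then show "v \<in> ?L"
      proof cases
        case 1
        then show ?thesis by (intro image_eqI[of _ _ i]) (auto simp: E_def)
      next
        case 2
        then show ?thesis by (intro image_eqI[of _ _ "n + i"]) (auto simp: E_def)
      qed
    qed
  qed
  have "inj_on (\<lambda>i. E i q) {..<n + m} \<and> independent ((\<lambda>i. E i q) ` {..<n + m}) \<and>
      span ((\<lambda>i. E i q) ` {..<n + m}) = T q" if q: "q \<in> U \<inter> U'" for q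
  proof -
    have FH: "F i q \<in> H q" if "i < n" for i
      unfolding F(5)[OF IntD1[OF q], symmetric] using that by (intro span_base) auto
    have GV: "G i q \<in> V q" if "i < m" for i
      unfolding G(5)[OF IntD2[OF q], symmetric] using that by (intro span_base) auto
    have oF: "orthogonal_nonzero q n (\<lambda>i. F i q)" and oG: "orthogonal_nonzero q m (\<lambda>i. G i q)"
      using F(4) G(4) q by auto
    have "orthogonal_nonzero q (n + m) (\<lambda>i. E i q)"
      unfolding orthogonal_nonzero_def
    proof (intro conjI allI impI)
      fix i assume i: "i < n + m"
      show "E i q \<in> T q" using E[OF i] field_tangent by blast
      show "E i q \<noteq> 0" using i oF oG by (auto simp: E_def orthogonal_nonzero_def)
      fix j assume j: "j < n + m" "i \<noteq> j"
      have *: "F i q \<in> H q" if "i < n" for i using FH that by blast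
      have **: "G (i - n) q \<in> V q" if "\<not> i < n" "i < n + m" for i using GV that by force
      have "g q (G (i - n) q) (G (j - n) q) = 0" if "\<not> i < n" "\<not> j < n"
      proof -
        have "i - n < m" "j - n < m" "i - n \<noteq> j - n" using that i j by auto
        then show ?thesis using oG unfolding orthogonal_nonzero_def by blast
      qed
      moreover have "g q (F i q) (F j q) = 0" if "i < n" "j < n"
        using oF that j unfolding orthogonal_nonzero_def by blast
      ultimately show "g q (E i q) (E j q) = 0"
        using HV_orthogonal[OF * **] VH_orthogonal[OF ** *] i j unfolding E_def by auto
    qed
    moreover have "span ((\<lambda>i. E i q) ` {..<n + m}) = T q"
    proof -
      have "span ((\<lambda>i. E i q) ` {..<n + m}) = {u + w |u w. u \<in> H q \<and> w \<in> V q}"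
        unfolding img span_Un F(5)[OF IntD1[OF q]] G(5)[OF IntD2[OF q]] by blast
      also have "\<dots> = T q" by (rule splitting_props(3))
      finally show ?thesis .
    qed
    ultimately show ?thesis
      using orthogonal_nonzero_inj orthogonal_nonzero_independent by blast
  qed
  moreover have "open (U \<inter> U')" "p \<in> U \<inter> U'" using F(1) G(1) U(1) U'(1) by auto
  ultimately show "\<exists>U (k::nat) E. open U \<and> p \<in> U \<and> (\<forall>i<k. E i \<in> XX) \<and>
      (\<forall>q\<in>U. inj_on (\<lambda>i. E i q) {..<k} \<and> independent ((\<lambda>i. E i q) ` {..<k}) \<and>
        span ((\<lambda>i. E i q) ` {..<k}) = T q)"
    using E by (intro exI[of _ "U \<inter> U'"] exI[of _ "n + m"] exI[of _ E]) (simp del: Int_iff)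
qed

definition sections :: "('m \<Rightarrow> 'm tvec set) \<Rightarrow> 'm vfield set" where
  "sections D = {X \<in> XX. \<forall>p. X p \<in> D p}"

lemma sectionsD: "X \<in> sections D \<Longrightarrow> X \<in> XX" "X \<in> sections D \<Longrightarrow> X p \<in> D p"
  by (auto simp: sections_def)

lemma pr_section: "tangent_subbundle D \<Longrightarrow> X \<in> XX \<Longrightarrow> pr g D X \<in> sections D"
  by (simp add: sections_def pr_field pr_in)

lemma pr_of_section: "tangent_subbundle D \<Longrightarrow> X \<in> sections D \<Longrightarrow> pr g D X = X"
  by (simp add: sections_def pr_id)

lemma section_add: "tangent_subbundle D \<Longrightarrow> X \<in> sections D \<Longrightarrow> Y \<in> sections D \<Longrightarrow> X + Y \<in> sections D"
  using subspace_add[OF subbundle_subspace] by (auto simp: sections_def field_add)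

lemma section_scale:
  "tangent_subbundle D \<Longrightarrow> f \<in> smooth_funs \<A> \<Longrightarrow> X \<in> sections D \<Longrightarrow> (\<lambda>q. f q *\<^sub>R X q) \<in> sections D"
  using subspace_scale[OF subbundle_subspace] field_scale by (auto simp: sections_def)

lemma pr_cross:
  assumes "X \<in> sections V"
  shows "pr g H X = 0"
proof
  fix p show "pr g H X p = 0 p"
    using sectionsD[OF assms] subspace_0[OF subbundle_subspace[OF H_subbundle]] VH_orthogonal
      g_zero H_tangent
    by (intro pr_unique H_subbundle) auto
qed

lemma pr_sum:
  assumes "X \<in> XX"
  shows "pr g H X p + pr g V X p = X p"
proof -
  obtain u w where uw: "u \<in> H p" "w \<in> V p" "X p = u + w"
    using field_tangent[OF assms, of p] unfolding splitting_props(3)[symmetric] by auto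
  have "pr g H X p = u"
    using uw VH_orthogonal H_tangent V_tangent
    by (intro pr_unique H_subbundle assms) (auto simp: g_add)
  moreover have "pr g V X p = w"
    using uw HV_orthogonal H_tangent V_tangent
    by (intro pr_unique V_subbundle assms) (auto simp: g_add)
  ultimately show ?thesis using uw by simp
qed

lemma affine: "affine_connection \<A> nabla"
  using levi_civita by (simp add: levi_civita_def)

lemma nabla_field: "X \<in> XX \<Longrightarrow> Y \<in> XX \<Longrightarrow> nabla X Y \<in> XX"
  using affine by (simp add: affine_connection_def)

lemma nabla_add:
  "X \<in> XX \<Longrightarrow> Y \<in> XX \<Longrightarrow> Z \<in> XX \<Longrightarrow> nabla (X + Y) Z = nabla X Z + nabla Y Z"
  "X \<in> XX \<Longrightarrow> Y \<in> XX \<Longrightarrow> Z \<in> XX \<Longrightarrow> nabla X (Y + Z) = nabla X Y + nabla X Z"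
  using affine unfolding affine_connection_def by blast+

lemma nabla_scale:
  "f \<in> smooth_funs \<A> \<Longrightarrow> X \<in> XX \<Longrightarrow> Y \<in> XX \<Longrightarrow>
     nabla (\<lambda>p. f p *\<^sub>R X p) Y = (\<lambda>p. f p *\<^sub>R nabla X Y p)"
  "f \<in> smooth_funs \<A> \<Longrightarrow> X \<in> XX \<Longrightarrow> Y \<in> XX \<Longrightarrow>
     nabla X (\<lambda>p. f p *\<^sub>R Y p) = (\<lambda>p. X p f *\<^sub>R Y p + f p *\<^sub>R nabla X Y p)"
  using affine unfolding affine_connection_def by blast+

lemma nabla_zero: "X \<in> XX \<Longrightarrow> nabla X 0 = 0" "X \<in> XX \<Longrightarrow> nabla 0 X = 0"
  using nabla_add(1)[of 0 0 X] nabla_add(2)[of X 0 0] field_zero(2) by simp_all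

lemma nabla_metric: "X \<in> XX \<Longrightarrow> Y \<in> XX \<Longrightarrow> Z \<in> XX \<Longrightarrow>
    X p (\<lambda>q. g q (Y q) (Z q)) = g p (nabla X Y p) (Z p) + g p (Y p) (nabla X Z p)"
  using levi_civita unfolding levi_civita_def by blast

text \<open>
  Since the connection has no torsion, the algebraic properties of brackets can be read off from
  those of the connection.
\<close>

lemma bracket_eq: "X \<in> XX \<Longrightarrow> Y \<in> XX \<Longrightarrow> lie_bracket X Y = nabla X Y - nabla Y X"
  using levi_civita unfolding levi_civita_def by metis

lemma bracket_field: "X \<in> XX \<Longrightarrow> Y \<in> XX \<Longrightarrow> lie_bracket X Y \<in> XX"
  by (simp add: bracket_eq nabla_field field_diff)

lemma bracket_add:
  "X \<in> XX \<Longrightarrow> Y \<in> XX \<Longrightarrow> Z \<in> XX \<Longrightarrow> lie_bracket (X + Y) Z = lie_bracket X Z + lie_bracket Y Z"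
  "X \<in> XX \<Longrightarrow> Y \<in> XX \<Longrightarrow> Z \<in> XX \<Longrightarrow> lie_bracket X (Y + Z) = lie_bracket X Y + lie_bracket X Z"
  by (simp_all add: bracket_eq nabla_add field_add)

lemma bracket_scale:
  assumes "f \<in> smooth_funs \<A>" "X \<in> XX" "Y \<in> XX"
  shows "lie_bracket (\<lambda>p. f p *\<^sub>R X p) Y p = f p *\<^sub>R lie_bracket X Y p - Y p f *\<^sub>R X p"
    and "lie_bracket X (\<lambda>p. f p *\<^sub>R Y p) p = X p f *\<^sub>R Y p + f p *\<^sub>R lie_bracket X Y p"
  using assms by (simp_all add: bracket_eq field_scale nabla_scale scale_right_diff_distrib)

lemma scaleR_fun_apply: "(c *\<^sub>R v) f = c *\<^sub>R v f"
  by (simp add: scaleR_fun_def)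

text \<open>The value \<open>(L\<^sub>X g)(a, b)\<close>.\<close>

definition lie_metric :: "'m vfield \<Rightarrow> 'm vfield \<Rightarrow> 'm vfield \<Rightarrow> 'm \<Rightarrow> real" where
  "lie_metric X a b p = X p (\<lambda>q. g q (a q) (b q)) -
     g p (lie_bracket X a p) (b p) - g p (a p) (lie_bracket X b p)"

lemma lie_metric_sym:
  assumes "X \<in> XX" "a \<in> XX" "b \<in> XX"
  shows "lie_metric X b a p = lie_metric X a b p"
proof -
  have "(\<lambda>q. g q (b q) (a q)) = (\<lambda>q. g q (a q) (b q))"
    using g_sym field_tangent assms by blast
  then show ?thesis
    using g_sym[of "lie_bracket X a p" p "b p"] g_sym[of "lie_bracket X b p" p "a p"]
      field_tangent bracket_field assms
    by (simp add: lie_metric_def)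
qed

lemma lie_metric_add:
  assumes "X \<in> XX" "Y \<in> XX" "a \<in> XX" "b \<in> XX"
  shows "lie_metric (X + Y) a b p = lie_metric X a b p + lie_metric Y a b p"
  using field_tangent[of _ p] assms bracket_field
  by (simp add: lie_metric_def bracket_add g_add g_add_right)

lemma lie_metric_add2:
  assumes "X \<in> XX" "a \<in> XX" "b \<in> XX" "c \<in> XX"
  shows "lie_metric X (a + b) c p = lie_metric X a c p + lie_metric X b c p"
proof -
  have "(\<lambda>q. g q ((a + b) q) (c q)) = (\<lambda>q. g q (a q) (c q) + g q (b q) (c q))"
    using field_tangent assms by (auto simp: g_add)
  then have "X p (\<lambda>q. g q ((a + b) q) (c q)) = X p (\<lambda>q. g q (a q) (c q)) + X p (\<lambda>q. g q (b q) (c q))"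
    using tangent_add[of "X p" p] field_tangent assms g_smooth by simp
  then show ?thesis
    using field_tangent[of _ p] assms bracket_field
    by (simp add: lie_metric_def bracket_add g_add)
qed

text \<open>
  The Lie derivative is not tensorial in \<open>X\<close> in general: the derivatives of the coefficient come
  multiplied by \<open>g(X, b)\<close> and \<open>g(a, X)\<close>, and these vanish because \<open>H\<close> and \<open>V\<close> are orthogonal.
\<close>

lemma lie_metric_scale:
  assumes "f \<in> smooth_funs \<A>" "X \<in> sections H" "a \<in> sections V" "b \<in> sections V"
  shows "lie_metric (\<lambda>q. f q *\<^sub>R X q) a b p = f p * lie_metric X a b p"
proof -
  note X = sectionsD[OF assms(2)] and a = sectionsD[OF assms(3)] and b = sectionsD[OF assms(4)]
  have t: "X p \<in> T p" "a p \<in> T p" "b p \<in> T p" "lie_bracket X a p \<in> T p" "lie_bracket X b p \<in> T p"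
    using X a b bracket_field field_tangent by auto
  show ?thesis
    unfolding lie_metric_def bracket_scale(1)[OF assms(1) X(1) a(1)] bracket_scale(1)[OF assms(1) X(1) b(1)]
    using t HV_orthogonal[OF X(2) b(2)] VH_orthogonal[OF a(2) X(2)]
    by (simp add: g_diff g_diff_right g_scale g_scale_right T_scale scaleR_fun_apply algebra_simps)
qed

lemma lie_metric_scale2:
  assumes "f \<in> smooth_funs \<A>" "X \<in> XX" "a \<in> XX" "b \<in> XX"
  shows "lie_metric X (\<lambda>q. f q *\<^sub>R a q) b p = f p * lie_metric X a b p"
proof -
  have t: "X p \<in> T p" "a p \<in> T p" "b p \<in> T p" "lie_bracket X a p \<in> T p" "lie_bracket X b p \<in> T p"
    using assms bracket_field field_tangent by auto
  have "(\<lambda>q. g q (f q *\<^sub>R a q) (b q)) = (\<lambda>q. f q * g q (a q) (b q))"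
    using field_tangent assms by (auto simp: g_scale)
  then have "X p (\<lambda>q. g q (f q *\<^sub>R a q) (b q)) = f p * X p (\<lambda>q. g q (a q) (b q)) + g p (a p) (b p) * X p f"
    using tangent_mult[OF t(1) assms(1)] assms g_smooth by simp
  then show ?thesis
    unfolding lie_metric_def bracket_scale(2)[OF assms(1-3)]
    using t by (simp add: g_add g_scale T_scale algebra_simps)
qed

text \<open>
  Tensoriality speaks of functionals on all vector fields; composing with the projections makes the
  Lie derivative, which is tensorial only on sections of \<open>H\<close> and \<open>V\<close>, such a functional.
\<close>

lemma lie_metric_pointwise:
  assumes X: "X \<in> sections H" "X' \<in> sections H" "X p = X' p"
    and a: "a \<in> sections V" "a' \<in> sections V" "a p = a' p"
  shows "lie_metric X a a p = lie_metric X' a' a' p"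
proof -
  note TM = tangent_space_subbundle
  have H: "pr g H Y \<in> sections H" and V: "pr g V Y \<in> sections V" if "Y \<in> XX" for Y
    using pr_section H_subbundle V_subbundle that by auto
  note Hf = sectionsD(1)[OF H] and Vf = sectionsD(1)[OF V]
  let ?L = "\<lambda>A B C. lie_metric (pr g H A) (pr g V B) (pr g V C) p"
  have 1: "tensorial_at p (\<lambda>A. ?L A B C)" if "B \<in> XX" "C \<in> XX" for B C
    unfolding tensorial_at_def
    using that H V Hf Vf by (simp add: pr_add pr_scale H_subbundle lie_metric_add lie_metric_scale)
  have 2: "tensorial_at p (\<lambda>B. ?L A B C)" if "A \<in> XX" "C \<in> XX" for A C
    unfolding tensorial_at_def
    using that Hf Vf by (simp add: pr_add pr_scale V_subbundle lie_metric_add2 lie_metric_scale2)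
  note f = X(1,2)[THEN sectionsD(1)] a(1,2)[THEN sectionsD(1)]
  have "?L X a a = ?L X' a a" by (rule tensorial_cong[OF TM 1]) (use f X in auto)
  also have "\<dots> = ?L X' a' a" by (rule tensorial_cong[OF TM 2]) (use f a in auto)
  also have "\<dots> = ?L X' a a'" using lie_metric_sym f Hf Vf by metis
  also have "\<dots> = ?L X' a' a'" by (rule tensorial_cong[OF TM 2]) (use f a in auto)
  finally show ?thesis using X a pr_of_section H_subbundle V_subbundle by simp
qed

text \<open>To first order, the flows of sections of \<open>D\<close> preserve the metric of \<open>D'\<close>.\<close>

definition preserved :: "('m \<Rightarrow> 'm tvec set) \<Rightarrow> ('m \<Rightarrow> 'm tvec set) \<Rightarrow> bool" where
  "preserved D D' \<longleftrightarrow> (\<forall>X\<in>sections D. \<forall>a\<in>sections D'. \<forall>b\<in>sections D'. \<forall>p. lie_metric X a b p = 0)"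

lemma preserved_polarize:
  assumes "\<And>X a p. X \<in> sections H \<Longrightarrow> a \<in> sections V \<Longrightarrow> lie_metric X a a p = 0"
  shows "preserved H V"
  unfolding preserved_def
proof (intro ballI allI)
  fix X a b p assume X: "X \<in> sections H" and a: "a \<in> sections V" and b: "b \<in> sections V"
  note f = X[THEN sectionsD(1)] a[THEN sectionsD(1)] b[THEN sectionsD(1)]
  have "lie_metric X (a + b) (a + b) p = 0" by (rule assms[OF X section_add[OF V_subbundle a b]])
  moreover have "lie_metric X (a + b) (a + b) p =
      lie_metric X a a p + lie_metric X a b p + (lie_metric X b a p + lie_metric X b b p)"
    using f lie_metric_sym lie_metric_add2 field_add by metis
  ultimately show "lie_metric X a b p = 0"
    using assms[OF X a] assms[OF X b] lie_metric_sym[OF f(1) f(2) f(3)] by simp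
qed

section \<open>The connection adapted to the splitting\<close>

abbreviation "R \<equiv> ring_nabla g H V nabla"

lemmas ring_nabla_fields = pr_field[OF H_subbundle] pr_field[OF V_subbundle] nabla_field bracket_field
  field_add

lemma ring_nabla_field: "A \<in> XX \<Longrightarrow> Z \<in> XX \<Longrightarrow> R A Z \<in> XX"
  unfolding ring_nabla_def by (intro ring_nabla_fields)

lemma ring_nabla_add:
  "A \<in> XX \<Longrightarrow> Y \<in> XX \<Longrightarrow> Z \<in> XX \<Longrightarrow> R A (Y + Z) = R A Y + R A Z"
  unfolding ring_nabla_def
  by (simp add: pr_add H_subbundle V_subbundle ring_nabla_fields nabla_add bracket_add)

text \<open>
  The four terms of the connection contribute the two components of \<open>A\<close> applied to \<open>f\<close>, times the two
  components of \<open>Z\<close>.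
\<close>

lemma ring_nabla_scale:
  assumes "f \<in> smooth_funs \<A>" "A \<in> XX" "Z \<in> XX"
  shows "R A (\<lambda>q. f q *\<^sub>R Z q) p = A p f *\<^sub>R Z p + f p *\<^sub>R R A Z p"
proof -
  note fields = ring_nabla_fields assms
  have *: "pr g D (\<lambda>q. X q f *\<^sub>R Y q + f q *\<^sub>R W q) p = X p f *\<^sub>R Y p + f p *\<^sub>R pr g D W p"
    if D: "tangent_subbundle D" and Y: "Y \<in> sections D" and X: "X \<in> XX" and W: "W \<in> XX" for D X Y W
  proof -
    have Xf: "(\<lambda>q. X q f) \<in> smooth_funs \<A>" by (rule field_smooth[OF X assms(1)])
    have "(\<lambda>q. X q f *\<^sub>R Y q + f q *\<^sub>R W q) = (\<lambda>q. X q f *\<^sub>R Y q) + (\<lambda>q. f q *\<^sub>R W q)" by auto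
    then show ?thesis
      using sectionsD(1)[OF Y] W
      by (simp add: pr_add[OF D] pr_scale[OF D] field_scale Xf assms(1) pr_of_section[OF D Y])
  qed
  let ?AH = "pr g H A" and ?AV = "pr g V A" and ?ZH = "pr g H Z" and ?ZV = "pr g V Z"
  have br: "lie_bracket X (\<lambda>q. f q *\<^sub>R Y q) = (\<lambda>q. X q f *\<^sub>R Y q + f q *\<^sub>R lie_bracket X Y q)"
    if "X \<in> XX" "Y \<in> XX" for X Y
    using bracket_scale(2)[OF assms(1) that] by blast
  have A: "A p f = ?AH p f + ?AV p f" using pr_sum[OF assms(2), of p] by (metis plus_fun_apply)
  have Z: "Z p = ?ZH p + ?ZV p" using pr_sum[OF assms(3), of p] by simp
  have s: "?ZH \<in> sections H" "?ZV \<in> sections V"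
    using pr_section H_subbundle V_subbundle assms by auto
  have plus: "(X + Y) p = X p + Y p" for X Y :: "'m vfield" by simp
  have "R A (\<lambda>q. f q *\<^sub>R Z q) p =
      (?AH p f *\<^sub>R ?ZH p + f p *\<^sub>R pr g H (nabla ?AH ?ZH) p) +
      (?AV p f *\<^sub>R ?ZV p + f p *\<^sub>R pr g V (nabla ?AV ?ZV) p) +
      (?AV p f *\<^sub>R ?ZH p + f p *\<^sub>R pr g H (lie_bracket ?AV ?ZH) p) +
      (?AH p f *\<^sub>R ?ZV p + f p *\<^sub>R pr g V (lie_bracket ?AH ?ZV) p)"
    unfolding ring_nabla_def plus
    by (simp only: pr_scale[OF H_subbundle assms(3,1)] pr_scale[OF V_subbundle assms(3,1)]
        nabla_scale(2) br fields * s H_subbundle V_subbundle)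
  also have "\<dots> = A p f *\<^sub>R Z p + f p *\<^sub>R R A Z p"
    unfolding ring_nabla_def A Z plus by (simp only: scaleR_add_left scaleR_add_right ac_simps)
  finally show ?thesis .
qed

text \<open>
  The right-hand side is tensorial in \<open>Z\<close> by the Leibniz rule, so it does define a form; the form is
  unique because every tangent vector is a value of some vector field.
\<close>

lemma nabla_form_props:
  assumes A: "A \<in> XX" and \<alpha>: "\<alpha> \<in> one_forms \<A>"
  shows "nabla_form \<A> R A \<alpha> \<in> one_forms \<A>"
    and "Z \<in> XX \<Longrightarrow> nabla_form \<A> R A \<alpha> p (Z p) = A p (\<lambda>q. \<alpha> q (Z q)) - \<alpha> p (R A Z p)"
proof -
  define \<Phi> where "\<Phi> Z p = A p (\<lambda>q. \<alpha> q (Z q)) - \<alpha> p (R A Z p)" for Z p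
  have lin: "\<alpha> q (u + v) = \<alpha> q u + \<alpha> q v" "\<alpha> q (c *\<^sub>R u) = c * \<alpha> q u" if "u \<in> T q" "v \<in> T q" for q c u v
    using \<alpha> that by (auto simp: one_forms_def cotangent_space_def)
  have smooth: "(\<lambda>q. \<alpha> q (Z q)) \<in> smooth_funs \<A>" if "Z \<in> XX" for Z
    using \<alpha> that by (simp add: one_forms_def)
  have add: "\<Phi> (X + Y) p = \<Phi> X p + \<Phi> Y p" if "X \<in> XX" "Y \<in> XX" for X Y p
  proof -
    have "(\<lambda>q. \<alpha> q ((X + Y) q)) = (\<lambda>q. \<alpha> q (X q) + \<alpha> q (Y q))"
      using lin field_tangent that by simp
    then show ?thesis
      using tangent_add[OF field_tangent[OF A] smooth smooth] that lin field_tangent ring_nabla_field A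
      by (simp add: \<Phi>_def ring_nabla_add)
  qed
  have scale: "\<Phi> (\<lambda>q. f q *\<^sub>R X q) p = f p * \<Phi> X p" if f: "f \<in> smooth_funs \<A>" and X: "X \<in> XX" for f X p
  proof -
    have t: "X p \<in> T p" "R A X p \<in> T p" using field_tangent ring_nabla_field A X by auto
    have "(\<lambda>q. \<alpha> q (f q *\<^sub>R X q)) = (\<lambda>q. f q * \<alpha> q (X q))"
      using lin(2) field_tangent X by blast
    then show ?thesis
      using tangent_mult[OF field_tangent[OF A] f smooth[OF X]] t
      by (simp add: \<Phi>_def ring_nabla_scale[OF f A X] lin T_scale algebra_simps)
  qed
  have tens: "tensorial_at p (\<lambda>Z. \<Phi> Z p)" for p
    unfolding tensorial_at_def using add scale by blast
  define extension where "extension p v = (SOME Z. Z \<in> XX \<and> Z p = v)" for p v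
  have extension: "extension p v \<in> XX" "extension p v p = v" if "v \<in> T p" for p v
    using someI_ex[of "\<lambda>Z. Z \<in> XX \<and> Z p = v"] tangent_extends[OF tangent_space_subbundle that]
    unfolding extension_def by blast+
  define \<omega> where "\<omega> p v = (if v \<in> T p then \<Phi> (extension p v) p else 0)" for p v
  have eval: "\<omega> p (Z p) = \<Phi> Z p" if "Z \<in> XX" for Z p
  proof -
    have t: "Z p \<in> T p" by (rule field_tangent[OF that])
    have "\<Phi> (extension p (Z p)) p = \<Phi> Z p"
      by (rule tensorial_cong[OF tangent_space_subbundle tens extension(1)[OF t] that extension(2)[OF t]])
    then show ?thesis using t by (simp add: \<omega>_def)
  qed
  have \<omega>_extension: "\<omega> p v = \<Phi> (extension p v) p" if "v \<in> T p" for p v using that by (simp add: \<omega>_def)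
  have \<omega>_scale: "\<omega> p (c *\<^sub>R u) = c * \<omega> p u" if u: "u \<in> T p" for p c u
  proof -
    have "\<omega> p (c *\<^sub>R extension p u p) = \<Phi> (\<lambda>q. c *\<^sub>R extension p u q) p"
      by (rule eval[OF field_scale[OF smooth_const extension(1)[OF u]]])
    also have "\<dots> = c * \<Phi> (extension p u) p" by (rule scale[OF smooth_const extension(1)[OF u]])
    finally show ?thesis unfolding extension(2)[OF u] \<omega>_extension[OF u] .
  qed
  have \<omega>_add: "\<omega> p (u + v) = \<omega> p u + \<omega> p v" if u: "u \<in> T p" and v: "v \<in> T p" for p u v
  proof -
    have "\<omega> p ((extension p u + extension p v) p) = \<Phi> (extension p u) p + \<Phi> (extension p v) p"
      unfolding eval[OF field_add[OF extension(1)[OF u] extension(1)[OF v]]] by (rule add[OF extension(1)[OF u] extension(1)[OF v]])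
    moreover have "(extension p u + extension p v) p = u + v" using extension(2)[OF u] extension(2)[OF v] by simp
    ultimately show ?thesis unfolding \<omega>_extension[OF u] \<omega>_extension[OF v] by simp
  qed
  have \<omega>_out: "\<omega> p v = 0" if "v \<notin> T p" for p v using that by (simp add: \<omega>_def)
  have "\<omega> p \<in> cotangent_space \<A> p" for p
    unfolding cotangent_space_def using \<omega>_add \<omega>_scale \<omega>_out by simp
  moreover have "(\<lambda>p. \<Phi> Z p) \<in> smooth_funs \<A>" if "Z \<in> XX" for Z
    unfolding \<Phi>_def
    by (rule smooth_diff[OF field_smooth[OF A smooth[OF that]] smooth[OF ring_nabla_field[OF A that]]])
  ultimately have \<omega>: "\<omega> \<in> one_forms \<A>" by (simp add: one_forms_def eval)
  have "nabla_form \<A> R A \<alpha> = \<omega>"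
    unfolding nabla_form_def \<Phi>_def[symmetric]
  proof (rule the_equality)
    show "\<omega> \<in> one_forms \<A> \<and> (\<forall>Z\<in>XX. \<forall>p. \<omega> p (Z p) = \<Phi> Z p)" using \<omega> eval by blast
    fix \<eta> assume \<eta>: "\<eta> \<in> one_forms \<A> \<and> (\<forall>Z\<in>XX. \<forall>p. \<eta> p (Z p) = \<Phi> Z p)"
    have "\<eta> p v = \<omega> p v" for p v
    proof (cases "v \<in> T p")
      case True
      then show ?thesis using \<eta> eval extension by metis
    next
      case False
      then show ?thesis using \<eta> \<omega> by (simp add: one_forms_def cotangent_space_def)
    qed
    then show "\<eta> = \<omega>" by blast
  qed
  then show "nabla_form \<A> R A \<alpha> \<in> one_forms \<A>"
    "Z \<in> XX \<Longrightarrow> nabla_form \<A> R A \<alpha> p (Z p) = A p (\<lambda>q. \<alpha> q (Z q)) - \<alpha> p (R A Z p)"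
    using \<omega> eval by (simp_all add: \<Phi>_def)
qed

lemma cometric_eval:
  assumes "tangent_subbundle D" "\<alpha> \<in> cotangent_space \<A> p" "\<beta> \<in> cotangent_space \<A> p"
  shows "cometric g D p \<alpha> \<beta> = \<alpha> (sharp g D p \<beta>)" "cometric g D p \<alpha> \<beta> = \<beta> (sharp g D p \<alpha>)"
proof -
  have D: "sharp g D p \<alpha> \<in> D p" "sharp g D p \<beta> \<in> D p"
    and eq: "\<And>w. w \<in> D p \<Longrightarrow> g p (sharp g D p \<alpha>) w = \<alpha> w"
      "\<And>w. w \<in> D p \<Longrightarrow> g p (sharp g D p \<beta>) w = \<beta> w"
    using sharp_props[OF assms(1) linear_at_cotangent] assms(2,3) by auto
  show "cometric g D p \<alpha> \<beta> = \<alpha> (sharp g D p \<beta>)" by (simp add: cometric_def eq(1) D)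
  have "g p (sharp g D p \<alpha>) (sharp g D p \<beta>) = g p (sharp g D p \<beta>) (sharp g D p \<alpha>)"
    by (rule g_sym) (use D subbundle_tangent[OF assms(1)] in auto)
  then show "cometric g D p \<alpha> \<beta> = \<beta> (sharp g D p \<alpha>)" by (simp add: cometric_def eq(2) D)
qed

lemma ring_nabla_section:
  assumes "A \<in> XX" "b \<in> sections V"
  shows "R A b = pr g V (nabla (pr g V A) b + lie_bracket (pr g H A) b)"
proof -
  note b = sectionsD(1)[OF assms(2)]
  have AH: "pr g H A \<in> XX" and AV: "pr g V A \<in> XX"
    using pr_field H_subbundle V_subbundle assms(1) by auto
  have "lie_bracket (pr g V A) 0 = 0"
    by (simp add: bracket_eq[OF AV field_zero(2)] nabla_zero AV)
  moreover have "pr g H 0 = 0"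
    by (rule pr_id[OF H_subbundle field_zero(2)])
      (simp add: subspace_0[OF subbundle_subspace[OF H_subbundle]])
  ultimately show ?thesis
    unfolding ring_nabla_def pr_cross[OF assms(2)] pr_of_section[OF V_subbundle assms(2)]
    by (simp add: nabla_zero AH pr_add V_subbundle nabla_field bracket_field AV b)
qed

text \<open>
  Restricted to \<open>V\<close>, the connection is metric along \<open>V\<close> because the Levi-Civita connection is. What
  its failure along \<open>H\<close> measures is the Lie derivative of the metric.
\<close>

lemma ring_nabla_metric_defect:
  assumes "A \<in> XX" "a \<in> sections V" "b \<in> sections V"
  shows "A p (\<lambda>q. g q (a q) (b q)) - g p (R A a p) (b p) - g p (a p) (R A b p) =
    lie_metric (pr g H A) a b p"
proof -
  note a = sectionsD[OF assms(2)] and b = sectionsD[OF assms(3)]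
  have AH: "pr g H A \<in> XX" and AV: "pr g V A \<in> XX"
    using pr_field H_subbundle V_subbundle assms(1) by auto
  let ?N = "\<lambda>c. nabla (pr g V A) c" and ?L = "\<lambda>c. lie_bracket (pr g H A) c"
  have f: "?N a \<in> XX" "?N b \<in> XX" "?L a \<in> XX" "?L b \<in> XX"
    using AH AV a(1) b(1) nabla_field bracket_field by auto
  have t: "c \<in> XX \<Longrightarrow> c p \<in> T p" for c by (rule field_tangent)
  have "g p (R A a p) (b p) = g p ((?N a + ?L a) p) (b p)"
    unfolding ring_nabla_section[OF assms(1,2)]
    by (rule g_pr[OF V_subbundle field_add[OF f(1,3)] b(2)])
  then have 1: "g p (R A a p) (b p) = g p (?N a p) (b p) + g p (?L a p) (b p)"
    using g_add t f b(1) by simp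
  have "g p (a p) (R A b p) = g p (a p) ((?N b + ?L b) p)"
    unfolding ring_nabla_section[OF assms(1,3)]
    by (rule g_pr_right[OF V_subbundle field_add[OF f(2,4)] a(2)])
  then have 2: "g p (a p) (R A b p) = g p (a p) (?N b p) + g p (a p) (?L b p)"
    using g_add_right t f a(1) by simp
  have "A p (\<lambda>q. g q (a q) (b q)) =
      pr g H A p (\<lambda>q. g q (a q) (b q)) + pr g V A p (\<lambda>q. g q (a q) (b q))"
    using pr_sum[OF assms(1), of p] by (metis plus_fun_apply)
  then show ?thesis
    unfolding 1 2 lie_metric_def nabla_metric[OF AV a(1) b(1), of p] by simp
qed

text \<open>
  The co-metric only sees the sections \<open>a\<close> and \<open>b\<close> of \<open>V\<close> that represent the two forms there, and
  the connection maps sections of \<open>V\<close> to sections of \<open>V\<close>. Hence the derivative of the co-metric is minus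
  the derivative of the metric on \<open>V\<close>.
\<close>

lemma nabla_bivector_eval:
  assumes A: "A \<in> XX" and \<alpha>: "\<alpha> \<in> one_forms \<A>" and \<beta>: "\<beta> \<in> one_forms \<A>"
  defines "a \<equiv> \<lambda>p. sharp g V p (\<alpha> p)" and "b \<equiv> \<lambda>p. sharp g V p (\<beta> p)"
  shows "nabla_bivector \<A> R (cometric g V) A \<alpha> \<beta> p = - lie_metric (pr g H A) a b p"
    and "a \<in> sections V" "b \<in> sections V"
proof -
  have cot: "\<gamma> q \<in> cotangent_space \<A> q" if "\<gamma> \<in> one_forms \<A>" for \<gamma> q
    using that by (simp add: one_forms_def)
  have sec: "(\<lambda>p. sharp g V p (\<gamma> p)) \<in> sections V" if "\<gamma> \<in> one_forms \<A>" for \<gamma>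
  proof -
    have lin: "linear_at q (\<gamma> q)" for q by (rule linear_at_cotangent[OF cot[OF that]])
    have "(\<lambda>p. \<gamma> p (X p)) \<in> smooth_funs \<A>" if "X \<in> XX" for X
      using \<open>\<gamma> \<in> one_forms \<A>\<close> that by (simp add: one_forms_def)
    then show ?thesis
      using sharp_field[OF V_subbundle lin] sharp_props(1)[OF V_subbundle lin]
      unfolding sections_def by blast
  qed
  show a: "a \<in> sections V" and b: "b \<in> sections V"
    unfolding a_def b_def using sec \<alpha> \<beta> by auto
  note nf = nabla_form_props[OF A]
  have rep: "\<gamma> q w = g q (sharp g V q (\<gamma> q)) w" if "\<gamma> \<in> one_forms \<A>" "w \<in> V q" for \<gamma> q w
    using sharp_props(2)[OF V_subbundle linear_at_cotangent[OF cot[OF that(1)]] that(2)] by simp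
  have \<alpha>b: "\<alpha> q (b q) = g q (a q) (b q)" for q
    unfolding a_def by (rule rep[OF \<alpha> sectionsD(2)[OF b]])
  have "g q (b q) (a q) = g q (a q) (b q)" for q
    by (rule g_sym) (use a b sectionsD(1) field_tangent in auto)
  then have \<beta>a: "\<beta> q (a q) = g q (a q) (b q)" for q
    using rep[OF \<beta> sectionsD(2)[OF a], of q] by (simp add: b_def)
  have R: "R A c q \<in> V q" if "c \<in> sections V" for c q
  proof -
    have "pr g V A \<in> XX" "pr g H A \<in> XX" using pr_field V_subbundle H_subbundle A by auto
    then show ?thesis
      unfolding ring_nabla_section[OF A that] using sectionsD(1)[OF that]
      by (intro pr_in V_subbundle field_add nabla_field bracket_field)
  qed
  have "cometric g V p (nabla_form \<A> R A \<alpha> p) (\<beta> p) = nabla_form \<A> R A \<alpha> p (b p)"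
    unfolding b_def by (rule cometric_eval(1)[OF V_subbundle cot[OF nf(1)[OF \<alpha>]] cot[OF \<beta>]])
  also have "\<dots> = A p (\<lambda>q. g q (a q) (b q)) - g p (a p) (R A b p)"
    unfolding nf(2)[OF \<alpha> sectionsD(1)[OF b]] \<alpha>b rep[OF \<alpha> R[OF b]] a_def ..
  finally have 1: "cometric g V p (nabla_form \<A> R A \<alpha> p) (\<beta> p) =
      A p (\<lambda>q. g q (a q) (b q)) - g p (a p) (R A b p)" .
  have "cometric g V p (\<alpha> p) (nabla_form \<A> R A \<beta> p) = nabla_form \<A> R A \<beta> p (a p)"
    unfolding a_def by (rule cometric_eval(2)[OF V_subbundle cot[OF \<alpha>] cot[OF nf(1)[OF \<beta>]]])
  also have "\<dots> = A p (\<lambda>q. g q (a q) (b q)) - g p (b p) (R A a p)"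
    unfolding nf(2)[OF \<beta> sectionsD(1)[OF a]] \<beta>a rep[OF \<beta> R[OF a]] b_def ..
  also have "g p (b p) (R A a p) = g p (R A a p) (b p)"
    by (rule g_sym) (use R[OF a] sectionsD(2)[OF b] V_tangent in auto)
  finally have 2: "cometric g V p (\<alpha> p) (nabla_form \<A> R A \<beta> p) =
      A p (\<lambda>q. g q (a q) (b q)) - g p (R A a p) (b p)" .
  have "cometric g V q (\<alpha> q) (\<beta> q) = g q (a q) (b q)" for q
    by (simp add: cometric_def a_def b_def)
  then show "nabla_bivector \<A> R (cometric g V) A \<alpha> \<beta> p = - lie_metric (pr g H A) a b p"
    unfolding nabla_bivector_def 1 2 ring_nabla_metric_defect[OF A a b, symmetric] by simp
qed

text \<open>
  Every section of \<open>V\<close> represents some one-form, namely the one it defines through the metric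
  (\<open>flat\<close>), so the converse direction loses no pair of sections.
\<close>

lemma parallel_iff_preserved: "parallel \<A> R (cometric g V) \<longleftrightarrow> preserved H V"
proof
  assume P: "preserved H V"
  show "parallel \<A> R (cometric g V)"
    unfolding parallel_def
  proof (intro ballI ext)
    fix A \<alpha> \<beta> p assume A: "A \<in> XX" and ab: "\<alpha> \<in> one_forms \<A>" "\<beta> \<in> one_forms \<A>"
    show "nabla_bivector \<A> R (cometric g V) A \<alpha> \<beta> p = 0 p"
      using nabla_bivector_eval[OF A ab] P pr_section[OF H_subbundle A] by (simp add: preserved_def)
  qed
next
  assume P: "parallel \<A> R (cometric g V)"
  show "preserved H V"
    unfolding preserved_def
  proof (intro ballI allI)
    fix X a b p assume X: "X \<in> sections H" and a: "a \<in> sections V" and b: "b \<in> sections V"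
    define flat where "flat c q v = (if v \<in> T q then g q (c q) v else 0)" for c q v
    have flat: "flat c \<in> one_forms \<A>" "(\<lambda>q. sharp g V q (flat c q)) = c" if c: "c \<in> sections V" for c
    proof -
      have ct: "c q \<in> T q" for q by (rule field_tangent[OF sectionsD(1)[OF c]])
      show "flat c \<in> one_forms \<A>"
        unfolding one_forms_def cotangent_space_def flat_def
        using g_add_right[OF _ _ ct] g_scale_right[OF _ ct] T_add T_scale field_tangent
          g_smooth[OF sectionsD(1)[OF c]] by simp
      show "(\<lambda>q. sharp g V q (flat c q)) = c"
        by (rule ext, rule sharp_unique[OF V_subbundle])
          (use sectionsD(2)[OF c] V_tangent in \<open>auto simp: flat_def\<close>)
    qed
    have "nabla_bivector \<A> R (cometric g V) X (flat a) (flat b) p = 0"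
      using P sectionsD(1)[OF X] flat(1) a b unfolding parallel_def by simp
    then show "lie_metric X a b p = 0"
      using nabla_bivector_eval(1)[OF sectionsD(1)[OF X] flat(1)[OF a] flat(1)[OF b], of p]
      by (simp add: flat(2) a b pr_of_section[OF H_subbundle X])
  qed
qed

text \<open>
  The hypotheses and the connection are symmetric in \<open>H\<close> and \<open>V\<close>, so every statement above holds with
  the two exchanged.
\<close>

lemma swap: "split_manifold \<A> g V H nabla"
proof
  have "{u + w |u w. u \<in> V p \<and> w \<in> H p} = T p" for p
    unfolding splitting_props(3)[symmetric] by (metis (no_types, lifting) add.commute)
  then show "orthogonal_splitting \<A> g V H"
    unfolding orthogonal_splitting_def
    using splitting_props(1,2,4) VH_orthogonal by (simp add: Int_commute)
qed (rule levi_civita)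

lemma ring_nabla_swap: "ring_nabla g V H nabla = R"
  by (intro ext) (simp add: ring_nabla_def add_ac)

section \<open>Gradients and commuting carre du champ operators\<close>

definition grad :: "('m \<Rightarrow> 'm tvec set) \<Rightarrow> ('m \<Rightarrow> real) \<Rightarrow> 'm vfield" where
  "grad D f p = sharp g D p (differential \<A> f p)"

lemma differential_apply: "v \<in> T p \<Longrightarrow> differential \<A> f p v = v f"
  by (simp add: differential_def)

lemma g_grad:
  assumes "tangent_subbundle D" "w \<in> D p"
  shows "g p (grad D f p) w = w f"
  unfolding grad_def
  using sharp_props(2)[OF assms(1) linear_at_cotangent[OF cotangent_differential] assms(2)]
    differential_apply subbundle_tangent[OF assms] by simp

lemma grad_section:
  assumes D: "tangent_subbundle D" and f: "f \<in> smooth_funs \<A>"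
  shows "grad D f \<in> sections D"
proof -
  have lin: "linear_at p (differential \<A> f p)" for p
    by (rule linear_at_cotangent[OF cotangent_differential])
  have "(\<lambda>p. differential \<A> f p (X p)) \<in> smooth_funs \<A>" if "X \<in> XX" for X
    using differential_one_form[OF f] that by (simp add: one_forms_def)
  then show ?thesis
    unfolding sections_def grad_def using sharp_field[OF D lin] sharp_props(1)[OF D lin] by blast
qed

lemma Gam_grad:
  assumes D: "tangent_subbundle D"
  shows "Gam \<A> (cometric g D) f h p = grad D f p h"
proof -
  have "grad D f p \<in> T p"
    unfolding grad_def
    using sharp_props(1)[OF D linear_at_cotangent[OF cotangent_differential]] subbundle_tangent[OF D]
    by blast
  then show ?thesis
    unfolding Gam_def cometric_eval(2)[OF D cotangent_differential cotangent_differential]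
    by (simp add: differential_apply flip: grad_def)
qed

lemma Gam_Gam:
  assumes "tangent_subbundle D" "tangent_subbundle D'" "f \<in> smooth_funs \<A>"
  shows "Gam \<A> (cometric g D) f (Gam \<A> (cometric g D') f f) p =
    grad D f p (\<lambda>q. g q (grad D' f q) (grad D' f q))"
proof -
  have "Gam \<A> (cometric g D') f f = (\<lambda>q. g q (grad D' f q) (grad D' f q))"
    using Gam_grad[OF assms(2)] g_grad[OF assms(2) sectionsD(2)[OF grad_section[OF assms(2,3)]]]
    by auto
  then show ?thesis by (simp add: Gam_grad[OF assms(1)])
qed

lemma g_gradient_sum:
  assumes "v \<in> T p"
  shows "g p v (grad H f p + grad V f p) = v f"
proof -
  obtain X where X: "X \<in> XX" "X p = v" using tangent_extends[OF tangent_space_subbundle assms] .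
  let ?h = "pr g H X p" and ?v = "pr g V X p"
  have h: "?h \<in> H p" and v: "?v \<in> V p" using pr_in H_subbundle V_subbundle X by auto
  have gr: "grad H f p \<in> H p" "grad V f p \<in> V p"
    unfolding grad_def
    using sharp_props(1)[OF _ linear_at_cotangent[OF cotangent_differential]] H_subbundle V_subbundle
    by auto
  have vs: "v = ?h + ?v" using pr_sum[OF X(1), of p] X(2) by simp
  have "g p v (grad H f p + grad V f p) = g p ?h (grad H f p) + g p ?v (grad V f p)"
    unfolding vs
    using h v gr H_tangent V_tangent HV_orthogonal VH_orthogonal T_add by (simp add: g_add g_add_right)
  also have "\<dots> = g p (grad H f p) ?h + g p (grad V f p) ?v"
    using g_sym h v gr H_tangent V_tangent by metis
  also have "\<dots> = ?h f + ?v f" using g_grad H_subbundle V_subbundle h v by simp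
  also have "\<dots> = v f" using arg_cong[OF vs, of "\<lambda>u. u f"] by simp
  finally show ?thesis .
qed

text \<open>
  Since \<open>x + z\<close> is the full gradient, \<open>g([x, z], x + z) = [x, z] f\<close>, and because
  \<open>z f = g(z, z)\<close> and \<open>x f = g(x, x)\<close> this is \<open>x g(z, z) - z g(x, x)\<close>, the difference of the two
  iterated operators. The difference of the two Lie derivatives is twice the bracket term minus this
  expression, hence equal to it. Unlike the left-hand side, the right-hand side is visibly free of
  second derivatives of \<open>f\<close>, by the tensoriality of the Lie derivatives.
\<close>

lemma Gam_commutator:
  assumes f: "f \<in> smooth_funs \<A>"
  defines "x \<equiv> grad H f" and "z \<equiv> grad V f"
  shows "Gam \<A> (cometric g H) f (Gam \<A> (cometric g V) f f) p -
      Gam \<A> (cometric g V) f (Gam \<A> (cometric g H) f f) p = lie_metric z x x p - lie_metric x z z p"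
proof -
  have s: "x \<in> sections H" "z \<in> sections V"
    unfolding x_def z_def using grad_section H_subbundle V_subbundle f by auto
  note x = sectionsD[OF s(1)] and z = sectionsD[OF s(2)]
  let ?b = "lie_bracket x z" and ?xx = "\<lambda>q. g q (x q) (x q)" and ?zz = "\<lambda>q. g q (z q) (z q)"
  have b: "?b p \<in> T p" and xp: "x p \<in> T p" and zp: "z p \<in> T p"
    using bracket_field x z field_tangent by auto
  have xf: "(\<lambda>q. x q f) = ?xx" and zf: "(\<lambda>q. z q f) = ?zz"
    using g_grad[OF H_subbundle x(2), where f = f] g_grad[OF V_subbundle z(2), where f = f]
    by (simp_all add: x_def z_def)
  have "g p (?b p) (x p) + g p (?b p) (z p) = ?b p f"
    using g_gradient_sum[OF b, where f = f] g_add_right[OF xp zp b] by (simp add: x_def z_def)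
  also have "\<dots> = x p ?zz - z p ?xx" by (simp add: lie_bracket_def xf zf)
  finally have *: "g p (?b p) (x p) + g p (?b p) (z p) = x p ?zz - z p ?xx" .
  have "lie_bracket z x = (\<lambda>q. (-1) *\<^sub>R ?b q)"
    using bracket_eq[OF x(1) z(1)] bracket_eq[OF z(1) x(1)] by auto
  then have "lie_metric z x x p = z p ?xx + 2 * g p (?b p) (x p)"
    using g_sym[OF b xp] g_scale[OF b xp, of "-1"] g_scale_right[OF b xp, of "-1"]
    by (simp add: lie_metric_def)
  moreover have "lie_metric x z z p = x p ?zz - 2 * g p (?b p) (z p)"
    using g_sym[OF b zp] by (simp add: lie_metric_def)
  ultimately show ?thesis
    unfolding Gam_Gam[OF H_subbundle V_subbundle f] Gam_Gam[OF V_subbundle H_subbundle f]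
    using * by (simp add: x_def z_def)
qed

text \<open>Take \<open>f\<close> with differential \<open>g(X + a, \<cdot>)\<close> at \<open>p\<close>.\<close>

lemma gradients_arbitrary:
  assumes "X \<in> sections H" "a \<in> sections V"
  obtains f where "f \<in> smooth_funs \<A>" "grad H f p = X p" "grad V f p = a p"
proof -
  note X = sectionsD[OF assms(1)] and a = sectionsD[OF assms(2)]
  have t: "X p \<in> T p" "a p \<in> T p" using X a field_tangent by auto
  obtain f where f: "f \<in> smooth_funs \<A>" "\<And>v. v \<in> T p \<Longrightarrow> v f = g p (X p + a p) v"
    using covector_is_differential[OF tangent_space_subbundle linear_at_metric[OF T_add[OF t]]] by blast
  have "grad H f p = X p"
    unfolding grad_def
  proof (rule sharp_unique[OF H_subbundle X(2)])
    fix w assume w: "w \<in> H p"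
    then show "g p (X p) w = differential \<A> f p w"
      using f(2)[OF H_tangent[OF w]] VH_orthogonal[OF a(2) w] H_tangent t by (simp add: differential_apply g_add)
  qed
  moreover have "grad V f p = a p"
    unfolding grad_def
  proof (rule sharp_unique[OF V_subbundle a(2)])
    fix w assume w: "w \<in> V p"
    then show "g p (a p) w = differential \<A> f p w"
      using f(2)[OF V_tangent[OF w]] HV_orthogonal[OF X(2) w] V_tangent t by (simp add: differential_apply g_add)
  qed
  ultimately show thesis using that f(1) by blast
qed

text \<open>
  If the operators commute, then \<open>(L\<^sub>X g)(a, a) = (L\<^sub>a g)(X, X)\<close> for all \<open>X\<close> in \<open>H\<close> and \<open>a\<close> in \<open>V\<close>, since
  their values at a point are those of gradients of one function. The left side is linear and the
  right side quadratic in \<open>X\<close>, so both vanish.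
\<close>

lemma Gam_commute_iff_preserved:
  "(\<forall>f\<in>smooth_funs \<A>. Gam \<A> (cometric g H) f (Gam \<A> (cometric g V) f f) =
      Gam \<A> (cometric g V) f (Gam \<A> (cometric g H) f f)) \<longleftrightarrow> preserved H V \<and> preserved V H"
  (is "?comm \<longleftrightarrow> _")
proof
  interpret swapped: split_manifold \<A> g V H nabla by (rule swap)
  assume comm: ?comm
  have eq: "lie_metric X a a p = lie_metric a X X p"
    if X: "X \<in> sections H" and a: "a \<in> sections V" for X a p
  proof -
    obtain f where f: "f \<in> smooth_funs \<A>" "grad H f p = X p" "grad V f p = a p"
      using gradients_arbitrary[OF X a] .
    have s: "grad H f \<in> sections H" "grad V f \<in> sections V"
      using grad_section H_subbundle V_subbundle f(1) by auto
    have "lie_metric (grad H f) (grad V f) (grad V f) p = lie_metric (grad V f) (grad H f) (grad H f) p"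
      using Gam_commutator[OF f(1), of p] comm f(1) by simp
    then show ?thesis
      using lie_metric_pointwise[OF s(1) X f(2) s(2) a f(3)]
        swapped.lie_metric_pointwise[OF s(2) a f(3) s(1) X f(2)] by simp
  qed
  have zero: "lie_metric X a a p = 0 \<and> lie_metric a X X p = 0"
    if X: "X \<in> sections H" and a: "a \<in> sections V" for X a p
  proof -
    \<comment> \<open>Doubling \<open>X\<close> multiplies the left side of the equation by 2 and the right side by 4.\<close>
    let ?Y = "\<lambda>q. 2 *\<^sub>R X q"
    note f = sectionsD(1)[OF X] sectionsD(1)[OF a]
    have Y: "?Y \<in> sections H" by (rule section_scale[OF H_subbundle smooth_const X])
    have "lie_metric ?Y a a p = 2 * lie_metric X a a p"
      by (rule lie_metric_scale[OF smooth_const X a a])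
    moreover have "lie_metric a ?Y ?Y p = 2 * lie_metric a X ?Y p"
      by (rule lie_metric_scale2[OF smooth_const f(2,1) sectionsD(1)[OF Y]])
    moreover have "lie_metric a X ?Y p = lie_metric a ?Y X p"
      by (rule lie_metric_sym[OF f(2) sectionsD(1)[OF Y] f(1)])
    moreover have "lie_metric a ?Y X p = 2 * lie_metric a X X p"
      by (rule lie_metric_scale2[OF smooth_const f(2,1,1)])
    ultimately show ?thesis using eq[OF X a, of p] eq[OF Y a, of p] by simp
  qed
  show "preserved H V \<and> preserved V H"
    using preserved_polarize swapped.preserved_polarize zero by blast
next
  assume P: "preserved H V \<and> preserved V H"
  show ?comm
  proof (intro ballI ext)
    fix f p assume f: "f \<in> smooth_funs \<A>"
    have "grad H f \<in> sections H" "grad V f \<in> sections V"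
      using grad_section H_subbundle V_subbundle f by auto
    then show "Gam \<A> (cometric g H) f (Gam \<A> (cometric g V) f f) p =
        Gam \<A> (cometric g V) f (Gam \<A> (cometric g H) f f) p"
      using P Gam_commutator[OF f, of p] by (simp add: preserved_def)
  qed
qed

end

theorem lemma4p1:
  fixes \<A> :: "('m::{t2_space, second_countable_topology}, 'e::euclidean_space) atlas"
    and g :: "'m metric_field"
    and H V :: "'m \<Rightarrow> 'm tvec set"
    and nabla :: "'m connection"
  assumes "smooth_atlas \<A>"
    and "riemannian_metric \<A> g"
    and "orthogonal_splitting \<A> g H V"
    and "levi_civita \<A> g nabla"
  shows "(\<forall>f\<in>smooth_funs \<A>.
            Gam \<A> (cometric g H) f (Gam \<A> (cometric g V) f f) =
            Gam \<A> (cometric g V) f (Gam \<A> (cometric g H) f f)) \<longleftrightarrow>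
         parallel \<A> (ring_nabla g H V nabla) (cometric g V) \<and>
         parallel \<A> (ring_nabla g H V nabla) (cometric g H)"
proof -
  interpret split_manifold \<A> g H V nabla by unfold_locales (fact assms)+
  interpret swapped: split_manifold \<A> g V H nabla by (rule swap)
  show ?thesis
    unfolding Gam_commute_iff_preserved parallel_iff_preserved
    using swapped.parallel_iff_preserved ring_nabla_swap by simp
qed

end
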